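(* Let $f,g,F$ be as in the context. Suppose that for every $\gamma>0$ and $x\in\mathbb{E}$ the set $\mathrm{prox}_{g/\gamma}(x)$ is nonempty, that $F$ has the Kurdyka–Łojasiewicz (KL) property at every point of $\mathrm{dom}\,\partial F$, and that $f$ is $L$-smooth for some $L>0$, i.e. $\|\nabla f(x)-\nabla f(y)\|\le L\|x-y\|$ for all $x,y\in\mathrm{conv}(\mathrm{dom}\,g)$. Let $\{x^k\}$ be a sequence generated by the auto-conditioned proximal gradient method (AC-PGM) with parameters $\alpha>1$, $L_0>0$ and $x^0\in\mathrm{dom}\,g$, satisfying $x^k\ne x^{k-1}$ for all $k\ge1$, and suppose that there exists a subsequence of $\{x^k\}$ converging to a point $x^*$. Then $$\sum_{k=1}^\infty\|x^k-x^{k-1}\|<\infty\quad\text{and}\quad F(x^k)\to F(x^* );$$ in particular, the whole sequence $\{x^k\}$ converges to $x^*$. Moreover, if $F$ has the KL property of exponent $\theta\in(0,1)$ at $x^*$, then: (i) if $\theta\in(0,1/2)$, then $\{F(x^k)\}$ and $\{x^k\}$ converge Q-superlinearly of order $\frac{1}{2\theta}$ (to $F(x^* )$ and $x^*$, respectively); (ii) if $\theta=1/2$, then $\{F(x^k)\}$ converges Q-linearly and $\{x^k\}$ converges R-linearly; (iii) if $\theta\in(1/2,1)$, then there exist $c_1,c_2>0$ such that, for all $k\geq 1$, $$F(x^k)-F(x^* )\le c_1k^{-\frac{1}{2\theta-1}},\qquad\|x^k-x^*\|\le c_2k^{-\frac{1-\theta}{2\theta-1}}.$$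
   Context: $\mathbb{E}$ is a finite-dimensional real inner product space with inner product $\langle\cdot,\cdot\rangle$ and induced norm $\|\cdot\|$; $\mathrm{dom}\,\phi=\{x\mid\phi(x)<\infty\}$; $\mathrm{conv}$ denotes convex hull; $\mathrm{dist}(0,A)=\inf_{a\in A}\|a\|$ (equal to $\infty$ for $A=\emptyset$). Problem: minimize $F(x):=f(x)+g(x)$ over $x\in\mathbb{E}$, where $f:\mathbb{E}\to(-\infty,\infty]$ is lower semicontinuous and continuously differentiable on an open set including $\mathrm{dom}\,g$, $g:\mathbb{E}\to(-\infty,\infty]$ is proper and lower semicontinuous, and $F^*:=\inf_{x\in\mathbb{E}}F(x)>-\infty$. When $f$ is assumed $L$-smooth on $\mathrm{conv}(\mathrm{dom}\,g)$, $f$ is understood to be continuously differentiable on an open set containing $\mathrm{conv}(\mathrm{dom}\,g)$. $\mathrm{prox}_{g/\gamma}(x):=\operatorname{argmin}_{y\in\mathbb{E}}\{g(y)+\frac{\gamma}{2}\|y-x\|^2\}$ (a set). Subdifferentials: for $x\in\mathrm{dom}\,F=\mathrm{dom}\,g$, the Fréchet subdifferential is $\widehat\partial F(x)=\{\xi\in\mathbb{E}\mid\liminf_{y\to x}\frac{F(y)-F(x)-\langle\xi,y-x\rangle}{\|y-x\|}\ge0\}$, with $\widehat\partial F(x)=\emptyset$ for $x\notin\mathrm{dom}\,g$; the limiting subdifferential is $\partial F(x)=\{\xi\mid\exists\,x^k\to x,\ F(x^k)\to F(x),\ \xi^k\to\xi,\ \xi^k\in\widehat\partial F(x^k)\}$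 for $x\in\mathrm{dom}\,g$ (empty otherwise); $\mathrm{dom}\,\partial F=\{x\mid\partial F(x)\ne\emptyset\}$. KL property: $F$ has the KL property at $\bar x\in\mathrm{dom}\,\partial F$ if there exist $\varpi>0$, a neighborhood $\mathcal{U}$ of $\bar x$, and a continuous concave function $\chi:[0,\varpi)\to[0,\infty)$, continuously differentiable on $(0,\varpi)$, with $\chi(0)=0$ and $\chi'(t)>0$ on $(0,\varpi)$, such that $\chi'(F(x)-F(\bar x))\,\mathrm{dist}(0,\partial F(x))\ge1$ for all $x\in\mathcal{U}$ with $F(\bar x)<F(x)<F(\bar x)+\varpi$. If this holds with $\chi(t)=ct^{1-\theta}$ for some $c>0$ and $\theta\in[0,1)$, $F$ is said to have the KL property of exponent $\theta$ at $\bar x$. AC-PGM: given $x^0\in\mathrm{dom}\,g$, $\alpha>1$, $L_0>0$, for $k=1,2,\dots$ compute $\gamma_k=\max\{L_0,\dots,L_{k-1}\}$; $x^k\in\mathrm{prox}_{g/(\alpha\gamma_k)}\big(x^{k-1}-\frac{1}{\alpha\gamma_k}\nabla f(x^{k-1})\big)$ (any choice); $L_k=\dfrac{2\big(f(x^k)-f(x^{k-1})-\langle\nabla f(x^{k-1}),x^k-x^{k-1}\rangle\big)}{\|x^k-x^{k-1}\|^2}$. Convergence rates: a sequence $a_k\to a$ converges Q-superlinearly of order $p>1$ if there is $M>0$ with $\|a_{k+1}-a\|\le M\|a_k-a\|^p$ for all sufficiently large $k$; Q-linearly if there is $\rho\in(0,1)$ with $\|a_{k+1}-a\|\le\rho\|a_k-a\|$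 for all sufficiently large $k$; R-linearly if there are $M>0$, $\rho\in(0,1)$ with $\|a_k-a\|\le M\rho^k$ for all sufficiently large $k$. *)

theory Defs
  imports "HOL-Analysis.Analysis"
begin

text \<open>
  Functions into \<open>(-\<infinity>, \<infinity>]\<close> are rendered with codomain \<^typ>\<open>ereal\<close>, and the value \<open>-\<infinity>\<close> is
  excluded by hypothesis. The space is of class \<^class>\<open>euclidean_space\<close>.
\<close>

definition edom :: "('a \<Rightarrow> ereal) \<Rightarrow> 'a set"
  where "edom \<phi> = {x. \<phi> x < \<infinity>}"

definition proper :: "('a \<Rightarrow> ereal) \<Rightarrow> bool"
  where "proper \<phi> \<longleftrightarrow> (\<forall>x. \<phi> x \<noteq> -\<infinity>) \<and> edom \<phi> \<noteq> {}"

definition lsc :: "('a::topological_space \<Rightarrow> ereal) \<Rightarrow> bool"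
  where "lsc \<phi> \<longleftrightarrow> (\<forall>x. \<phi> x \<le> Liminf (at x) \<phi>)"

definition grad :: "('a::euclidean_space \<Rightarrow> ereal) \<Rightarrow> 'a \<Rightarrow> 'a"
  where "grad f x = (THE d. GDERIV (\<lambda>y. real_of_ereal (f y)) x :> d)"

definition C1_on :: "'a set \<Rightarrow> ('a::euclidean_space \<Rightarrow> ereal) \<Rightarrow> bool"
  where "C1_on U f \<longleftrightarrow>
    (\<forall>x\<in>U. \<bar>f x\<bar> \<noteq> \<infinity> \<and> (\<exists>d. GDERIV (\<lambda>y. real_of_ereal (f y)) x :> d)) \<and>
    continuous_on U (grad f)"

definition L_smooth_on :: "real \<Rightarrow> 'a set \<Rightarrow> ('a::euclidean_space \<Rightarrow> ereal) \<Rightarrow> bool"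
  where "L_smooth_on Lf S f \<longleftrightarrow>
    (\<exists>U. open U \<and> S \<subseteq> U \<and> C1_on U f) \<and>
    (\<forall>x\<in>S. \<forall>y\<in>S. norm (grad f x - grad f y) \<le> Lf * norm (x - y))"

text \<open>\<open>prox g \<gamma> x\<close> is the set usually written \<open>prox\<^bsub>g/\<gamma>\<^esub>(x)\<close>.\<close>

definition prox :: "('a::euclidean_space \<Rightarrow> ereal) \<Rightarrow> real \<Rightarrow> 'a \<Rightarrow> 'a set"
  where "prox g \<gamma> x =
    {y. is_arg_min (\<lambda>y. g y + ereal (\<gamma> / 2 * (norm (y - x))\<^sup>2)) (\<lambda>_. True) y}"

definition frechet_subdiff :: "('a::euclidean_space \<Rightarrow> ereal) \<Rightarrow> 'a \<Rightarrow> 'a set"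
  where "frechet_subdiff F x = (if x \<in> edom F
    then {\<xi>. Liminf (at x) (\<lambda>y. (F y - F x - ereal (\<xi> \<bullet> (y - x))) / ereal (norm (y - x))) \<ge> 0}
    else {})"

definition limiting_subdiff :: "('a::euclidean_space \<Rightarrow> ereal) \<Rightarrow> 'a \<Rightarrow> 'a set"
  where "limiting_subdiff F x = (if x \<in> edom F
    then {\<xi>. \<exists>X \<Xi>. X \<longlonglongrightarrow> x \<and> (\<lambda>k. F (X k)) \<longlonglongrightarrow> F x \<and> \<Xi> \<longlonglongrightarrow> \<xi> \<and>
                (\<forall>k::nat. \<Xi> k \<in> frechet_subdiff F (X k))}
    else {})"

definition dom_subdiff :: "('a::euclidean_space \<Rightarrow> ereal) \<Rightarrow> 'a set"
  where "dom_subdiff F = {x. limiting_subdiff F x \<noteq> {}}"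

text \<open>Valued in \<^typ>\<open>ereal\<close>, so that the distance to the empty set is \<open>\<infinity>\<close>.\<close>

definition dist0 :: "'a::real_normed_vector set \<Rightarrow> ereal"
  where "dist0 A = (INF a\<in>A. ereal (norm a))"

definition desingularizing :: "real \<Rightarrow> (real \<Rightarrow> real) \<Rightarrow> bool"
  where "desingularizing \<omega> \<phi> \<longleftrightarrow>
    \<phi> ` {0..<\<omega>} \<subseteq> {0..} \<and> continuous_on {0..<\<omega>} \<phi> \<and> concave_on {0..<\<omega>} \<phi> \<and>
    (\<forall>t\<in>{0<..<\<omega>}. \<phi> differentiable (at t)) \<and> continuous_on {0<..<\<omega>} (deriv \<phi>) \<and>
    \<phi> 0 = 0 \<and> (\<forall>t\<in>{0<..<\<omega>}. deriv \<phi> t > 0)"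

definition KL_with :: "('a::euclidean_space \<Rightarrow> ereal) \<Rightarrow> 'a \<Rightarrow> (real \<Rightarrow> real) \<Rightarrow> bool"
  where "KL_with F xb \<phi> \<longleftrightarrow> xb \<in> dom_subdiff F \<and>
    (\<exists>\<omega>>0. \<exists>U. open U \<and> xb \<in> U \<and> desingularizing \<omega> \<phi> \<and>
      (\<forall>x\<in>U. F xb < F x \<and> F x < F xb + ereal \<omega> \<longrightarrow>
        ereal (deriv \<phi> (real_of_ereal (F x - F xb))) * dist0 (limiting_subdiff F x) \<ge> 1))"

definition KL_property :: "('a::euclidean_space \<Rightarrow> ereal) \<Rightarrow> 'a \<Rightarrow> bool"
  where "KL_property F xb \<longleftrightarrow> (\<exists>\<phi>. KL_with F xb \<phi>)"

definition KL_exponent :: "('a::euclidean_space \<Rightarrow> ereal) \<Rightarrow> real \<Rightarrow> 'a \<Rightarrow> bool"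
  where "KL_exponent F \<theta> xb \<longleftrightarrow>
    0 \<le> \<theta> \<and> \<theta> < 1 \<and> (\<exists>c>0. KL_with F xb (\<lambda>t. c * t powr (1 - \<theta>)))"

text \<open>The initial parameter \<open>L\<^sub>0\<close> is \<open>L 0\<close>; the value \<open>\<gamma> 0\<close> is not used.\<close>

definition ac_pgm :: "('a::euclidean_space \<Rightarrow> ereal) \<Rightarrow> ('a \<Rightarrow> ereal) \<Rightarrow> real \<Rightarrow>
    (nat \<Rightarrow> real) \<Rightarrow> (nat \<Rightarrow> real) \<Rightarrow> (nat \<Rightarrow> 'a) \<Rightarrow> bool"
  where "ac_pgm f g \<alpha> L \<gamma> x \<longleftrightarrow> \<alpha> > 1 \<and> L 0 > 0 \<and> x 0 \<in> edom g \<and>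
    (\<forall>k\<ge>1.
      \<gamma> k = Max (L ` {0..k-1}) \<and>
      x k \<in> prox g (\<alpha> * \<gamma> k) (x (k-1) - (1 / (\<alpha> * \<gamma> k)) *\<^sub>R grad f (x (k-1))) \<and>
      L k = 2 * (real_of_ereal (f (x k)) - real_of_ereal (f (x (k-1)))
                  - grad f (x (k-1)) \<bullet> (x k - x (k-1))) / (norm (x k - x (k-1)))\<^sup>2)"

definition Q_superlinear :: "real \<Rightarrow> (nat \<Rightarrow> 'a::real_normed_vector) \<Rightarrow> 'a \<Rightarrow> bool"
  where "Q_superlinear p a l \<longleftrightarrow> p > 1 \<and> a \<longlonglongrightarrow> l \<and>
    (\<exists>M>0. \<forall>\<^sub>F k in sequentially. norm (a (Suc k) - l) \<le> M * norm (a k - l) powr p)"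

definition Q_linear :: "(nat \<Rightarrow> 'a::real_normed_vector) \<Rightarrow> 'a \<Rightarrow> bool"
  where "Q_linear a l \<longleftrightarrow> a \<longlonglongrightarrow> l \<and>
    (\<exists>\<rho>. 0 < \<rho> \<and> \<rho> < 1 \<and> (\<forall>\<^sub>F k in sequentially. norm (a (Suc k) - l) \<le> \<rho> * norm (a k - l)))"

definition R_linear :: "(nat \<Rightarrow> 'a::real_normed_vector) \<Rightarrow> 'a \<Rightarrow> bool"
  where "R_linear a l \<longleftrightarrow> a \<longlonglongrightarrow> l \<and>
    (\<exists>M>0. \<exists>\<rho>. 0 < \<rho> \<and> \<rho> < 1 \<and> (\<forall>\<^sub>F k in sequentially. norm (a k - l) \<le> M * \<rho> ^ k))"

end

theory Submission
  imports Defs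
begin

text \<open>
  A proximal step compares \<open>F (x (k+1))\<close> with \<open>F\<close> at any point of \<open>dom g\<close>. Comparing with \<open>x k\<close> gives
  sufficient decrease for all large \<open>k\<close>, although no backtracking takes place: the bounded monotone
  sequence \<open>\<gamma>\<close> converges, so eventually \<open>L k < \<alpha> * \<gamma> k\<close> with uniform slack. The optimality condition of the
  step yields a subgradient of size \<open>O(\<parallel>x (k+1) - x k\<parallel>)\<close>, and the KL inequality makes the lengths
  of the steps summable. Comparing with the limit point bounds both the gap
  \<open>F (x (k+1)) - F xs\<close> and the squared step by a multiple of \<open>\<parallel>x k - xs\<parallel>\<^sup>2\<close>. This bound on the step turns
  the KL inequality \<open>(F (x (k+1)) - F xs) powr \<theta> \<le> C * \<parallel>x (k+1) - x k\<parallel>\<close> into superlinear convergence of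
  the iterates themselves when \<open>\<theta> < 1/2\<close>.
\<close>

section \<open>Finite length from the KL inequality\<close>

text \<open>A concave function lies below its tangents. Both points stay positive because the slope
  of \<open>\<phi>\<close> may be infinite at 0, as for
  \<open>t powr (1 - \<theta>)\<close>.\<close>

lemma desingularizing_tangent:
  assumes "desingularizing \<omega> \<phi>" "0 < s" "s < \<omega>" "0 < t" "t < \<omega>"
  shows "deriv \<phi> t * (t - s) \<le> \<phi> t - \<phi> s"
proof -
  have *: "convex_on {0<..<\<omega>} (\<lambda>u. - \<phi> u)"
    by (rule convex_on_subset[of "{0..<\<omega>}"])
      (use assms(1) in \<open>auto simp: desingularizing_def concave_on_def\<close>)
  have "\<phi> differentiable (at t)"
    using assms by (simp add: desingularizing_def)
  then have "(\<phi> has_real_derivative deriv \<phi> t) (at t)"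
    by (simp add: DERIV_deriv_iff_real_differentiable)
  then have d: "((\<lambda>u. - \<phi> u) has_real_derivative - deriv \<phi> t) (at t within {0<..<\<omega>})"
    by (rule DERIV_minus[OF has_field_derivative_at_within])
  have "- \<phi> s - - \<phi> t \<ge> - deriv \<phi> t * (s - t)"
    using assms by (intro convex_on_imp_above_tangent[OF * _ _ _ d]) (auto simp: interior_open)
  then show ?thesis by (simp add: algebra_simps)
qed

text \<open>One of the two copies of \<open>d (Suc j)\<close> pays for the \<open>d j\<close> of the
  next inequality, and the differences of \<open>e\<close> telescope.\<close>

lemma summed_recursion_bound:
  fixes d e :: "nat \<Rightarrow> real"
  assumes "m \<le> n" "\<And>j. m \<le> j \<Longrightarrow> j < n \<Longrightarrow> 2 * d (Suc j) \<le> d j + (e j - e (Suc j))"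
  shows "(\<Sum>j=m..<n. d (Suc j)) + d n \<le> d m + (e m - e n)"
  using assms
proof (induction n rule: dec_induct)
  case (step n)
  have "2 * d (Suc n) \<le> d n + (e n - e (Suc n))"
    using step by simp
  moreover have "(\<Sum>j=m..<n. d (Suc j)) + d n \<le> d m + (e m - e n)"
    by (rule step.IH) (use step in simp)
  ultimately show ?case using step.hyps by simp
qed simp

lemma norm_diff_le_sum_steps:
  fixes x :: "nat \<Rightarrow> 'a::real_normed_vector"
  assumes "m \<le> n"
  shows "norm (x n - x m) \<le> (\<Sum>j=m..<n. norm (x (Suc j) - x j))"
  using assms
proof (induction n rule: dec_induct)
  case (step n)
  have "norm (x (Suc n) - x m) \<le> norm (x (Suc n) - x n) + norm (x n - x m)"
    by (metis norm_triangle_ineq diff_add_cancel add_diff_eq)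
  then show ?case using step by simp
qed simp

lemma steps_tendsto_0:
  fixes d r :: "nat \<Rightarrow> real"
  assumes "a > 0" "r \<longlonglongrightarrow> l" "\<And>k. d k \<ge> 0"
    and "\<forall>\<^sub>F k in sequentially. a * (d k)\<^sup>2 \<le> r k - r (Suc k)"
  shows "d \<longlonglongrightarrow> 0"
proof -
  have 1: "(\<lambda>k. (r k - r (Suc k)) / a) \<longlonglongrightarrow> 0"
    using tendsto_divide[OF tendsto_diff[OF assms(2) LIMSEQ_Suc[OF assms(2)]] tendsto_const, of a] \<open>a > 0\<close>
    by simp
  have "\<forall>\<^sub>F k in sequentially. (d k)\<^sup>2 \<le> (r k - r (Suc k)) / a"
    using assms(4) by eventually_elim (use \<open>a > 0\<close> in \<open>simp add: pos_le_divide_eq mult.commute\<close>)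
  then have "(\<lambda>k. (d k)\<^sup>2) \<longlonglongrightarrow> 0"
    by (intro tendsto_sandwich[OF _ _ tendsto_const 1]) auto
  then have "(\<lambda>k. sqrt ((d k)\<^sup>2)) \<longlonglongrightarrow> sqrt 0" by (rule tendsto_real_sqrt)
  then show ?thesis using assms(3) by simp
qed

text \<open>Descent, concavity of \<open>\<phi>\<close> and KL combine into a recursion whose sum
  telescopes. KL is local, so the iterates must first be trapped in the ball: this happens once some
  \<open>x m\<close> is close to \<open>xs\<close> and the length still to come is small. The last
  conclusion is the input for the rates.\<close>

lemma KL_finite_length:
  fixes x :: "nat \<Rightarrow> 'a::euclidean_space" and r :: "nat \<Rightarrow> real"
  defines "d \<equiv> \<lambda>k. norm (x (Suc k) - x k)"
  assumes "a > 0" "b > 0" "\<omega> > 0" "\<rho> > 0"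
    and desc: "\<And>k. a * (d k)\<^sup>2 \<le> r k - r (Suc k)"
    and rpos: "\<And>k. r k > 0"
    and rlim: "r \<longlonglongrightarrow> 0"
    and sub: "strict_mono s" "(x \<circ> s) \<longlonglongrightarrow> xs"
    and des: "desingularizing \<omega> \<phi>"
    and KL: "\<And>k. x (Suc k) \<in> ball xs \<rho> \<Longrightarrow> r (Suc k) < \<omega> \<Longrightarrow> 1 \<le> deriv \<phi> (r (Suc k)) * (b * d k)"
  shows "summable d" "x \<longlonglongrightarrow> xs"
    and "\<forall>\<^sub>F k in sequentially. 1 \<le> deriv \<phi> (r (Suc k)) * (b * d k) \<and>
           norm (x k - xs) \<le> 2 * d k + b / a * \<phi> (r (Suc k))"
proof -
  \<comment> \<open>The factor \<open>b / a\<close> is the subgradient constant over the descent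
    constant. The index is \<open>Suc k\<close> because the subgradient at \<open>x (Suc k)\<close>
    is controlled by the step \<open>d k\<close> leading there.\<close>
  define e where "e = (\<lambda>k. b / a * \<phi> (r (Suc k)))"
  have dnn: "d k \<ge> 0" for k by (simp add: d_def)
  have phinn: "\<phi> t \<ge> 0" if "0 \<le> t" "t < \<omega>" for t
    using des that by (auto simp: desingularizing_def image_subset_iff)
  have step: "2 * d (Suc k) \<le> d k + (e k - e (Suc k))"
    if "x (Suc k) \<in> ball xs \<rho>" "r (Suc k) < \<omega>" "r (Suc (Suc k)) < \<omega>" for k
  proof -
    let ?D = "deriv \<phi> (r (Suc k))"
    have kl: "1 \<le> ?D * (b * d k)" using KL that by blast
    have tan: "?D * (r (Suc k) - r (Suc (Suc k))) \<le> \<phi> (r (Suc k)) - \<phi> (r (Suc (Suc k)))"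
      by (rule desingularizing_tangent[OF des]) (use rpos that in auto)
    have Dpos: "?D > 0" using des rpos that by (auto simp: desingularizing_def)
    \<comment> \<open>Descent of the following step, scaled by the slope: concavity turns the
      decrement of \<open>r\<close> into one of \<open>\<phi>\<close>, hence of
      \<open>e\<close>.\<close>
    have "?D * (a * (d (Suc k))\<^sup>2) \<le> ?D * (r (Suc k) - r (Suc (Suc k)))"
      using desc[of "Suc k"] Dpos by (intro mult_left_mono) auto
    also have "\<dots> \<le> \<phi> (r (Suc k)) - \<phi> (r (Suc (Suc k)))" by (rule tan)
    also have "\<dots> = (a / b) * (e k - e (Suc k))" using assms by (simp add: e_def field_simps)
    finally have "a * (?D * b * (d (Suc k))\<^sup>2) \<le> a * (e k - e (Suc k))"
      using \<open>b > 0\<close> by (simp add: field_simps)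
    then have 1: "?D * b * (d (Suc k))\<^sup>2 \<le> e k - e (Suc k)"
      using \<open>a > 0\<close> by simp
    \<comment> \<open>KL replaces the slope by \<open>1 / (b * d k)\<close>. The square is then
      bounded by a product, which the arithmetic-geometric mean inequality splits.\<close>
    have "1 * (d (Suc k))\<^sup>2 \<le> ?D * (b * d k) * (d (Suc k))\<^sup>2"
      by (rule mult_right_mono[OF kl]) simp
    also have "\<dots> = d k * (?D * b * (d (Suc k))\<^sup>2)" by simp
    also have "\<dots> \<le> d k * (e k - e (Suc k))" by (rule mult_left_mono[OF 1 dnn])
    finally have 2: "(d (Suc k))\<^sup>2 \<le> d k * (e k - e (Suc k))" by simp
    have 3: "0 \<le> e k - e (Suc k)"
      using 1 Dpos assms by (smt (verit) mult_nonneg_nonneg zero_le_power2)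
    have "d (Suc k) = sqrt ((d (Suc k))\<^sup>2)" using dnn by simp
    also have "\<dots> \<le> sqrt (d k * (e k - e (Suc k)))" using 2 by (rule real_sqrt_le_mono)
    also have "\<dots> \<le> (d k + (e k - e (Suc k))) / 2" by (rule arith_geo_mean_sqrt[OF dnn 3])
    finally show ?thesis by simp
  qed
  have d0: "d \<longlonglongrightarrow> 0"
    by (rule steps_tendsto_0[OF \<open>a > 0\<close> rlim]) (use desc dnn in auto)
  have phi0: "(\<lambda>k. \<phi> (r k)) \<longlonglongrightarrow> 0"
  proof -
    have "\<forall>\<^sub>F k in sequentially. r k < \<omega>"
      using order_tendstoD(2)[OF rlim \<open>\<omega> > 0\<close>] .
    then have "\<forall>\<^sub>F k in sequentially. r k \<in> {0..<\<omega>}"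
      by (rule eventually_mono) (use rpos in \<open>simp add: less_imp_le\<close>)
    moreover have "continuous_on {0..<\<omega>} \<phi>"
      using des by (simp add: desingularizing_def)
    ultimately have "(\<lambda>k. \<phi> (r k)) \<longlonglongrightarrow> \<phi> 0"
      using \<open>\<omega> > 0\<close> by (intro continuous_on_tendsto_compose[OF _ rlim, of "{0..<\<omega>}"]) auto
    then show ?thesis using des by (simp add: desingularizing_def)
  qed
  have e0: "e \<longlonglongrightarrow> 0"
    unfolding e_def using tendsto_mult_right_zero[OF LIMSEQ_Suc[OF phi0], of "b / a"] .
  obtain N where N: "\<And>k. k \<ge> N \<Longrightarrow> r k < \<omega>"
    using order_tendstoD(2)[OF rlim \<open>\<omega> > 0\<close>] by (auto simp: eventually_sequentially)
  \<comment> \<open>The sum is the distance to \<open>xs\<close> at index \<open>m\<close> plus a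
    bound \<open>2 * d m + e m\<close> on all length travelled afterwards. It tends to 0 along the
    subsequence.\<close>
  obtain m where m: "m \<ge> N" "norm (x m - xs) + 2 * d m + e m < \<rho>"
  proof -
    have "(\<lambda>k. norm ((x \<circ> s) k - xs) + 2 * (d \<circ> s) k + (e \<circ> s) k) \<longlonglongrightarrow> norm (xs - xs) + 2 * 0 + 0"
      by (intro tendsto_intros sub(2) LIMSEQ_subseq_LIMSEQ[OF d0 sub(1)] LIMSEQ_subseq_LIMSEQ[OF e0 sub(1)])
    then have "\<forall>\<^sub>F k in sequentially. norm ((x \<circ> s) k - xs) + 2 * (d \<circ> s) k + (e \<circ> s) k < \<rho>"
      using order_tendstoD(2) assms by fastforce
    then obtain k where "k \<ge> N" "norm ((x \<circ> s) k - xs) + 2 * (d \<circ> s) k + (e \<circ> s) k < \<rho>"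
      unfolding eventually_sequentially by (metis linear)
    then show ?thesis using that[of "s k"] seq_suble[OF sub(1), of k] by simp
  qed
  have enn: "e k \<ge> 0" if "k \<ge> N" for k
    using phinn[of "r (Suc k)"] N[of "Suc k"] rpos[of "Suc k"] that assms by (simp add: e_def)
  have split_first: "(\<Sum>j=k..<Suc n. d j) = d k + (\<Sum>j=k..<n. d (Suc j))" if "k \<le> n" for k n
    unfolding sum.atLeast_Suc_lessThan[OF le_imp_less_Suc[OF that]] sum.shift_bounds_Suc_ivl ..
  \<comment> \<open>Strong induction: the length from \<open>x m\<close> to \<open>x (Suc n)\<close>
    is bounded by the recursion at indices below \<open>n\<close>, which needs only the earlier
    iterates to lie in the ball.\<close>
  have ball: "x (Suc n) \<in> ball xs \<rho>" if "n \<ge> m" for n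
    using that
  proof (induction n rule: less_induct)
    case (less n)
    have "(\<Sum>j=m..<n. d (Suc j)) + d n \<le> d m + (e m - e n)"
      by (rule summed_recursion_bound) (use less step N m in auto)
    moreover have "(\<Sum>j=m..<Suc n. d j) = d m + (\<Sum>j=m..<n. d (Suc j))"
      by (rule split_first[OF less.prems])
    moreover have "norm (x (Suc n) - x m) \<le> (\<Sum>j=m..<Suc n. d j)"
      unfolding d_def using less.prems by (intro norm_diff_le_sum_steps) auto
    moreover have "norm (x (Suc n) - xs) \<le> norm (x (Suc n) - x m) + norm (x m - xs)"
      by (metis norm_triangle_ineq diff_add_cancel add_diff_eq)
    ultimately have "norm (x (Suc n) - xs) < \<rho>"
      using m enn[of n] less.prems dnn[of n] by linarith
    then show ?case by (simp add: dist_norm norm_minus_commute)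
  qed
  \<comment> \<open>With all late iterates trapped, the recursion holds from any
    \<open>k \<ge> m\<close> on, and the bound is independent of \<open>n\<close>.\<close>
  have tail: "(\<Sum>j=k..<n. d j) \<le> 2 * d k + e k" if "k \<ge> m" for k n
  proof (cases "k < n")
    case True
    have "(\<Sum>j=k..<n. d (Suc j)) + d n \<le> d k + (e k - e n)"
      by (rule summed_recursion_bound) (use True that step N m ball in auto)
    moreover have "(\<Sum>j=k..<Suc n. d j) = d k + (\<Sum>j=k..<n. d (Suc j))"
      by (rule split_first) (use True in simp)
    ultimately show ?thesis using True enn[of n] dnn[of n] that m by simp
  next
    case False
    then show ?thesis using dnn[of k] enn[of k] that m by simp
  qed
  show sumd: "summable d"
  proof -
    have "summable (\<lambda>k. d (k + m))"
    proof (rule bounded_imp_summable)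
      fix n
      have "(\<Sum>k\<le>n. d (k + m)) = (\<Sum>j=m..<Suc n + m. d j)"
        using sum.shift_bounds_nat_ivl[of d 0 m "Suc n"] by (simp add: atLeast0LessThan lessThan_Suc_atMost)
      then show "(\<Sum>k\<le>n. d (k + m)) \<le> 2 * d m + e m" using tail[of m "Suc n + m"] by simp
    qed (use dnn in auto)
    then show ?thesis by (simp add: summable_iff_shift)
  qed
  show xlim: "x \<longlonglongrightarrow> xs"
  proof -
    have "summable (\<lambda>k. x (Suc k) - x k)"
      by (rule summable_norm_cancel) (use sumd in \<open>simp add: d_def\<close>)
    then have "convergent (\<lambda>n. \<Sum>k<n. x (Suc k) - x k)"
      by (simp add: summable_iff_convergent)
    then have "convergent (\<lambda>n. x n - x 0)" by (simp add: sum_lessThan_telescope)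
    then have "convergent x" using convergent_diff_const_right_iff by blast
    then obtain l where l: "x \<longlonglongrightarrow> l" by (auto simp: convergent_def)
    then have "l = xs" using LIMSEQ_subseq_LIMSEQ[OF l sub(1)] sub(2) LIMSEQ_unique by blast
    then show ?thesis using l by simp
  qed
  have "1 \<le> deriv \<phi> (r (Suc k)) * (b * d k) \<and> norm (x k - xs) \<le> 2 * d k + b / a * \<phi> (r (Suc k))"
    if "k \<ge> m" for k
  proof
    show "1 \<le> deriv \<phi> (r (Suc k)) * (b * d k)"
      using KL[of k] ball[OF that] N[of "Suc k"] that m by simp
    \<comment> \<open>Let \<open>n\<close> tend to infinity in the tail bound.\<close>
    have "(\<lambda>n. norm (x n - x k)) \<longlonglongrightarrow> norm (xs - x k)"
      using xlim by (intro tendsto_intros)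
    moreover have "norm (x n - x k) \<le> 2 * d k + e k" if "n \<ge> k" for n
      using norm_diff_le_sum_steps[OF that, of x] tail[OF \<open>k \<ge> m\<close>, of n] unfolding d_def by linarith
    ultimately have "norm (xs - x k) \<le> 2 * d k + e k"
      by (intro LIMSEQ_le_const2) auto
    then show "norm (x k - xs) \<le> 2 * d k + b / a * \<phi> (r (Suc k))"
      by (simp add: e_def norm_minus_commute)
  qed
  then show "\<forall>\<^sub>F k in sequentially. 1 \<le> deriv \<phi> (r (Suc k)) * (b * d k) \<and>
           norm (x k - xs) \<le> 2 * d k + b / a * \<phi> (r (Suc k))"
    unfolding eventually_sequentially by blast
qed

section \<open>Convergence rates\<close>

text \<open>For consecutive values \<open>u\<close> and \<open>v\<close> of a decreasing sequence,
  \<open>t powr (- p)\<close> grows by a fixed amount per step. If \<open>u \<le> 2 * v\<close>, the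
  mean value theorem applies with the intermediate point below \<open>2 * v\<close>; otherwise
  halving alone multiplies the power by at least \<open>2 powr p\<close>.\<close>

lemma powr_neg_diff_ge:
  fixes p :: real
  assumes "p > 0" "C > 0" "0 < v" "v < u" "v powr (1 + p) \<le> C * (u - v)" "u \<le> M"
  shows "min (p / (2 powr (1 + p) * C)) ((2 powr p - 1) * M powr (- p)) \<le> v powr (- p) - u powr (- p)"
proof (cases "u \<le> 2 * v")
  case True
  have "((\<lambda>t. t powr (- p)) has_real_derivative - p * t powr (- p - 1)) (at t)" if "t \<ge> v" for t
    using that assms by (auto intro!: derivative_eq_intros)
  from MVT2[OF \<open>v < u\<close> this] obtain z where z: "v < z" "z < u"
    "u powr (- p) - v powr (- p) = (u - v) * (- p * z powr (- p - 1))" by blast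
  have "p / (2 powr (1 + p) * C) \<le> p * ((u - v) / (2 * v) powr (1 + p))"
  proof -
    have "v powr (1 + p) * (2 powr (1 + p)) \<le> C * (u - v) * (2 powr (1 + p))"
      using assms by (intro mult_right_mono) auto
    then have "1 / (2 powr (1 + p) * C) \<le> (u - v) / (2 * v) powr (1 + p)"
      using assms by (simp add: powr_mult field_simps)
    then show ?thesis using mult_left_mono[of _ _ p] assms by fastforce
  qed
  also have "\<dots> \<le> p * ((u - v) / z powr (1 + p))"
    using z True assms by (intro mult_left_mono divide_left_mono powr_mono2 mult_pos_pos) auto
  also have "\<dots> = v powr (- p) - u powr (- p)"
  proof -
    have "z powr (- p - 1) = 1 / z powr (1 + p)"
      unfolding powr_minus_divide[symmetric] by (rule arg_cong2[where f = "(powr)"]) auto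
    then show ?thesis using z(3) by (simp add: algebra_simps diff_divide_distrib)
  qed
  finally show ?thesis by simp
next
  case False
  have "M powr (- p) \<le> u powr (- p)" using assms by (intro powr_mono2') auto
  then have "(2 powr p - 1) * M powr (- p) \<le> (2 powr p - 1) * u powr (- p)"
    using assms by (intro mult_left_mono) (auto simp: ge_one_powr_ge_zero)
  also have "\<dots> = (u / 2) powr (- p) - u powr (- p)"
    using assms by (simp add: powr_divide powr_minus field_simps)
  also have "(u / 2) powr (- p) \<le> v powr (- p)"
    using assms False by (intro powr_mono2') auto
  finally show ?thesis by simp
qed

text \<open>Since \<open>r k powr (- p)\<close> grows at least linearly in \<open>k\<close>,
  inverting the power gives the rate.\<close>

lemma sublinear_rate:
  fixes r :: "nat \<Rightarrow> real"
  assumes "p > 0" "C > 0"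
    and ev: "\<forall>\<^sub>F k in sequentially. 0 < r (Suc k) \<and> r (Suc k) < r k \<and> r (Suc k) powr (1 + p) \<le> C * (r k - r (Suc k))"
  shows "\<exists>c. \<forall>\<^sub>F k in sequentially. r k \<le> c * real k powr (- (1 / p))"
proof -
  obtain N where N: "\<And>k. k \<ge> N \<Longrightarrow> 0 < r (Suc k) \<and> r (Suc k) < r k \<and> r (Suc k) powr (1 + p) \<le> C * (r k - r (Suc k))"
    using ev unfolding eventually_sequentially by blast
  have rpos: "r k > 0" if "k \<ge> N" for k using N[OF that] by linarith
  \<comment> \<open>The growth per step, with \<open>r N\<close> as the upper bound \<open>M\<close>
    for all later values.\<close>
  define \<mu> where "\<mu> = min (p / (2 powr (1 + p) * C)) ((2 powr p - 1) * r N powr (- p))"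
  have "2 powr 0 < (2::real) powr p" using assms(1) by (intro powr_less_mono) auto
  then have mu: "\<mu> > 0" using assms(1,2) rpos[of N] by (simp add: \<mu>_def)
  have dec: "r (N + j) \<le> r N" for j
  proof (induction j)
    case (Suc j)
    then show ?case using N[of "N + j"] by simp
  qed simp
  have "\<mu> * real j \<le> r (N + j) powr (- p)" for j
  proof (induction j)
    case (Suc j)
    have "\<mu> \<le> r (Suc (N + j)) powr (- p) - r (N + j) powr (- p)"
      unfolding \<mu>_def
      by (rule powr_neg_diff_ge) (use assms(1,2) N[of "N + j"] dec in auto)
    then show ?case using Suc by (simp add: algebra_simps)
  qed simp
  then have 1: "\<mu> * real (k - N) \<le> r k powr (- p)" if "k \<ge> N" for k
    using that by (metis le_add_diff_inverse)
  \<comment> \<open>The threshold ensures \<open>k - N \<ge> k / 2\<close> and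
    \<open>k > 0\<close>.\<close>
  have "r k \<le> (\<mu> / 2) powr (- (1 / p)) * real k powr (- (1 / p))" if "k \<ge> 2 * N + 1" for k
  proof -
    have "\<mu> / 2 * real k \<le> \<mu> * real (k - N)"
      using that mu by (simp add: of_nat_diff field_simps)
    also have "\<dots> \<le> r k powr (- p)" using 1 that by simp
    finally have "(r k powr (- p)) powr (- (1 / p)) \<le> (\<mu> / 2 * real k) powr (- (1 / p))"
      using mu that assms(1) by (intro powr_mono2') auto
    also have "(r k powr (- p)) powr (- (1 / p)) = r k"
      using assms(1) rpos[of k] that by (simp add: powr_powr)
    also have "(\<mu> / 2 * real k) powr (- (1 / p)) = (\<mu> / 2) powr (- (1 / p)) * real k powr (- (1 / p))"
      using mu by (intro powr_mult)
    finally show ?thesis .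
  qed
  then show ?thesis unfolding eventually_sequentially by blast
qed

text \<open>Finitely many exceptional indices are absorbed by enlarging the constant.\<close>

lemma eventually_le_imp_all_le:
  fixes u v :: "nat \<Rightarrow> real"
  assumes "\<forall>\<^sub>F k in sequentially. u k \<le> c * v k" "\<And>k. k \<ge> 1 \<Longrightarrow> v k > 0"
  shows "\<exists>c>0. \<forall>k\<ge>1. u k \<le> c * v k"
proof -
  obtain N where N: "\<And>k. k \<ge> N \<Longrightarrow> u k \<le> c * v k"
    using assms(1) unfolding eventually_sequentially by blast
  \<comment> \<open>The sum dominates each early ratio. Absolute values keep the summand at 0
    nonnegative, where the sign of \<open>v\<close> is unknown.\<close>
  define c' where "c' = \<bar>c\<bar> + (\<Sum>k\<le>N. \<bar>u k\<bar> / \<bar>v k\<bar>) + 1"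
  have s: "(\<Sum>k\<le>N. \<bar>u k\<bar> / \<bar>v k\<bar>) \<ge> 0" by (intro sum_nonneg) auto
  have "u k \<le> c' * v k" if "k \<ge> 1" for k
  proof (cases "k \<ge> N")
    case True
    have "c * v k \<le> c' * v k"
      using s assms(2)[OF that] by (intro mult_right_mono) (auto simp: c'_def)
    then show ?thesis using N[OF True] by linarith
  next
    case False
    have "\<bar>u k\<bar> / \<bar>v k\<bar> \<le> (\<Sum>k\<le>N. \<bar>u k\<bar> / \<bar>v k\<bar>)"
      by (rule member_le_sum) (use False in auto)
    then have "\<bar>u k\<bar> / v k \<le> c'" using assms(2)[OF that] by (simp add: c'_def)
    then show ?thesis using assms(2)[OF that] by (simp add: pos_divide_le_eq)
  qed
  moreover have "c' > 0" using s by (simp add: c'_def)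
  ultimately show ?thesis by blast
qed

lemma geometric_bound:
  fixes r :: "nat \<Rightarrow> real"
  assumes "0 < q" "\<forall>\<^sub>F k in sequentially. r (Suc k) \<le> q * r k"
  shows "\<exists>M>0. \<forall>\<^sub>F k in sequentially. r k \<le> M * q ^ k"
proof -
  obtain N where N: "\<And>k. k \<ge> N \<Longrightarrow> r (Suc k) \<le> q * r k"
    using assms unfolding eventually_sequentially by blast
  have *: "r (N + j) \<le> r N * q ^ j" for j
  proof (induction j)
    case (Suc j)
    have "r (Suc (N + j)) \<le> q * r (N + j)" using N by simp
    also have "\<dots> \<le> q * (r N * q ^ j)" using Suc assms by (intro mult_left_mono) auto
    finally show ?case by (simp add: mult_ac)
  qed simp
  define M where "M = \<bar>r N / q ^ N\<bar> + 1"
  have "r k \<le> M * q ^ k" if "k \<ge> N" for k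
  proof -
    have "r k \<le> r N * q ^ (k - N)" using *[of "k - N"] that by simp
    also have "\<dots> = r N / q ^ N * q ^ k" using assms that by (simp add: power_diff)
    also have "\<dots> \<le> M * q ^ k"
      using \<open>0 < q\<close> abs_ge_self[of "r N / q ^ N"] unfolding M_def
      by (intro mult_right_mono zero_le_power) linarith+
    finally show ?thesis .
  qed
  moreover have "M > 0" unfolding M_def by (rule add_nonneg_pos) auto
  ultimately show ?thesis unfolding eventually_sequentially by blast
qed

text \<open>Squaring KL and inserting descent gives the scalar recursion \<open>rec\<close>, which
  yields the three regimes for \<open>r\<close>. The tail bound transfers them to \<open>x\<close>
  through \<open>xbound\<close>, except for the superlinear case, where the bound of
  \<open>d k\<close> by \<open>norm (x k - xs)\<close> closes a recursion in the distances
  themselves.\<close>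

lemma KL_rates:
  fixes x :: "nat \<Rightarrow> 'a::real_normed_vector" and r :: "nat \<Rightarrow> real"
  defines "d \<equiv> \<lambda>k. norm (x (Suc k) - x k)"
  assumes "a > 0" "A > 0" "C > 0" "B \<ge> 0" "0 < \<theta>" "\<theta> < 1"
    and rlim: "r \<longlonglongrightarrow> 0" and xlim: "x \<longlonglongrightarrow> xs"
    and good: "\<forall>\<^sub>F k in sequentially. 0 < r (Suc k) \<and> r (Suc k) < r k \<and>
      a * (d k)\<^sup>2 \<le> r k - r (Suc k) \<and> d k \<le> A * norm (x k - xs)"
    and KL: "\<forall>\<^sub>F k in sequentially. r (Suc k) powr \<theta> \<le> C * d k"
    and tail: "\<forall>\<^sub>F k in sequentially. norm (x k - xs) \<le> 2 * d k + B * r (Suc k) powr (1 - \<theta>)"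
  shows "\<theta> < 1/2 \<Longrightarrow> Q_superlinear (1 / (2 * \<theta>)) r 0"
    and "\<theta> < 1/2 \<Longrightarrow> Q_superlinear (1 / (2 * \<theta>)) x xs"
    and "\<theta> = 1/2 \<Longrightarrow> Q_linear r 0"
    and "\<theta> = 1/2 \<Longrightarrow> R_linear x xs"
    and "1/2 < \<theta> \<Longrightarrow> \<exists>c>0. \<forall>k\<ge>1. r k \<le> c * real k powr (- (1 / (2 * \<theta> - 1)))"
    and "1/2 < \<theta> \<Longrightarrow> \<exists>c>0. \<forall>k\<ge>1. norm (x k - xs) \<le> c * real k powr (- ((1 - \<theta>) / (2 * \<theta> - 1)))"
proof -
  \<comment> \<open>\<open>E\<close> arises from \<open>(C * d k)\<close> squared when the squared
    step is replaced by the decrement over \<open>a\<close>. \<open>G\<close> adds the coefficient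
    of \<open>2 * d k\<close>, with \<open>d k \<le> sqrt (r k / a)\<close>, to that of the power
    term.\<close>
  define E where "E = C\<^sup>2 / a"
  define G where "G = 2 / sqrt a + B"
  have E: "E > 0" and G: "G > 0" using assms by (auto simp: E_def G_def intro: add_pos_nonneg)
  have dnn: "d k \<ge> 0" for k by (simp add: d_def)
  have rec: "\<forall>\<^sub>F k in sequentially. r (Suc k) powr (2 * \<theta>) \<le> E * (r k - r (Suc k))"
    using KL good
  proof eventually_elim
    case (elim k)
    have "r (Suc k) powr (2 * \<theta>) = (r (Suc k) powr \<theta>)\<^sup>2"
      using powr_powr[of "r (Suc k)" \<theta> 2] elim by (simp add: mult.commute)
    also have "\<dots> \<le> (C * d k)\<^sup>2" by (rule power_mono[OF elim(1)]) simp
    also have "\<dots> = E * (a * (d k)\<^sup>2)" using assms by (simp add: E_def power_mult_distrib)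
    also have "\<dots> \<le> E * (r k - r (Suc k))" using elim E by (intro mult_left_mono) auto
    finally show ?case .
  qed
  have small: "\<forall>\<^sub>F k in sequentially. r k < 1"
    using order_tendstoD(2)[OF rlim] by simp
  \<comment> \<open>The two terms of the tail bound have orders \<open>1 / 2\<close> and
    \<open>1 - \<theta>\<close> in \<open>r k\<close>; as \<open>r k < 1\<close>, the smaller
    exponent dominates.\<close>
  have xbound: "\<forall>\<^sub>F k in sequentially. norm (x k - xs) \<le> G * r k powr (min (1 / 2) (1 - \<theta>))"
    using tail small good
  proof eventually_elim
    case (elim k)
    have rk: "0 < r k" "0 < r (Suc k)" "r (Suc k) < r k" using elim by auto
    have "a * (d k)\<^sup>2 \<le> r k" using elim by linarith
    then have "(d k)\<^sup>2 \<le> r k / a" using \<open>a > 0\<close> by (simp add: pos_le_divide_eq mult.commute)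
    then have dsqrt: "d k \<le> sqrt (r k) / sqrt a"
      using real_le_rsqrt[of "d k" "r k / a"] by (simp add: real_sqrt_divide)
    let ?m = "min (1 / 2) (1 - \<theta>)"
    have "sqrt (r k) \<le> r k powr ?m"
      using elim(2) rk by (simp only: powr_half_sqrt[symmetric] less_imp_le) (intro powr_mono', auto simp: min_def)
    then have "d k \<le> r k powr ?m / sqrt a"
      using dsqrt \<open>a > 0\<close> by (meson divide_right_mono order_trans real_sqrt_ge_zero less_imp_le)
    moreover have "r (Suc k) powr (1 - \<theta>) \<le> r k powr ?m"
    proof -
      have "r (Suc k) powr (1 - \<theta>) \<le> r k powr (1 - \<theta>)"
        using rk \<open>\<theta> < 1\<close> by (intro powr_mono2) (auto simp: less_imp_le)
      also have "\<dots> \<le> r k powr ?m" using elim(2) rk by (intro powr_mono') auto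
      finally show ?thesis .
    qed
    then have "B * r (Suc k) powr (1 - \<theta>) \<le> B * r k powr ?m"
      using assms by (intro mult_left_mono)
    ultimately show ?case using elim by (simp add: G_def algebra_simps)
  qed
  show "Q_superlinear (1 / (2 * \<theta>)) r 0" if "\<theta> < 1/2"
    unfolding Q_superlinear_def
  proof (intro conjI exI[of _ "E powr (1 / (2 * \<theta>))"])
    show "\<forall>\<^sub>F k in sequentially. norm (r (Suc k) - 0) \<le> E powr (1 / (2 * \<theta>)) * norm (r k - 0) powr (1 / (2 * \<theta>))"
      using rec good
    proof eventually_elim
      case (elim k)
      have rk: "0 < r k" "0 < r (Suc k)" using elim by auto
      \<comment> \<open>Dropping \<open>r (Suc k)\<close> on the right loses nothing in the order
        when \<open>2 * \<theta> < 1\<close>.\<close>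
      have "E * (r k - r (Suc k)) \<le> E * r k"
        using E rk by simp
      then have "r (Suc k) powr (2 * \<theta>) \<le> E * r k" using elim by linarith
      then have "(r (Suc k) powr (2 * \<theta>)) powr (1 / (2 * \<theta>)) \<le> (E * r k) powr (1 / (2 * \<theta>))"
        using assms by (intro powr_mono2) auto
      then show ?case
        using rk E \<open>0 < \<theta>\<close> by (simp add: powr_powr powr_mult abs_of_pos)
    qed
  qed (use that assms E in auto)
  show "Q_superlinear (1 / (2 * \<theta>)) x xs" if "\<theta> < 1/2"
    unfolding Q_superlinear_def
  proof (intro conjI exI[of _ "G * (C * A) powr (1 / (2 * \<theta>))"])
    have "\<forall>\<^sub>F k in sequentially. norm (x (Suc k) - xs) \<le> G * r (Suc k) powr (min (1 / 2) (1 - \<theta>))"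
      using xbound eventually_sequentially_Suc[where P = "\<lambda>k. norm (x k - xs) \<le> G * r k powr (min (1 / 2) (1 - \<theta>))"] by blast
    then show "\<forall>\<^sub>F k in sequentially. norm (x (Suc k) - xs) \<le> G * (C * A) powr (1 / (2 * \<theta>)) * norm (x k - xs) powr (1 / (2 * \<theta>))"
      using KL good
    proof eventually_elim
      case (elim k)
      \<comment> \<open>The exponent \<open>1 / (2 * \<theta>)\<close> turns
        \<open>r powr \<theta>\<close> into the square root of \<open>r\<close>, which bounds the
        next distance by \<open>xbound\<close>.\<close>
      have "r (Suc k) powr \<theta> \<le> C * (A * norm (x k - xs))"
        using elim(2,3) mult_left_mono[of "d k" "A * norm (x k - xs)" C] \<open>C > 0\<close> by linarith
      then have "(r (Suc k) powr \<theta>) powr (1 / (2 * \<theta>)) \<le> (C * A * norm (x k - xs)) powr (1 / (2 * \<theta>))"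
        using assms by (intro powr_mono2) (auto simp: mult_ac)
      also have "(r (Suc k) powr \<theta>) powr (1 / (2 * \<theta>)) = r (Suc k) powr (1 / 2)"
        using assms by (simp add: powr_powr)
      also have "(C * A * norm (x k - xs)) powr (1 / (2 * \<theta>)) = (C * A) powr (1 / (2 * \<theta>)) * norm (x k - xs) powr (1 / (2 * \<theta>))"
        using assms by (intro powr_mult)
      finally have "G * r (Suc k) powr (1 / 2) \<le> G * ((C * A) powr (1 / (2 * \<theta>)) * norm (x k - xs) powr (1 / (2 * \<theta>)))"
        using G by (intro mult_left_mono) auto
      moreover have m: "min (1 / 2) (1 - \<theta>) = 1 / 2" using that by simp
      ultimately show ?case using elim(1)[unfolded m] by (simp only: mult.assoc)
    qed
  qed (use that assms G in auto)
  \<comment> \<open>The recursion for \<open>2 * \<theta> = 1\<close>, solved for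
    \<open>r (Suc k)\<close>, has this ratio.\<close>
  define q where "q = E / (1 + E)"
  have q: "0 < q" "q < 1" using E by (auto simp: q_def)
  have lin: "\<forall>\<^sub>F k in sequentially. r (Suc k) \<le> q * r k" if "\<theta> = 1/2"
    using rec good
  proof eventually_elim
    case (elim k)
    then have "r (Suc k) * (1 + E) \<le> E * r k"
      using that by (simp add: algebra_simps)
    then show ?case using E by (simp add: q_def field_simps)
  qed
  show "Q_linear r 0" if "\<theta> = 1/2"
    unfolding Q_linear_def
  proof (intro conjI exI[of _ q] q rlim)
    show "\<forall>\<^sub>F k in sequentially. norm (r (Suc k) - 0) \<le> q * norm (r k - 0)"
      using lin[OF that] good by eventually_elim auto
  qed
  show "R_linear x xs" if half: "\<theta> = 1/2"
  proof -
    obtain M where M: "M > 0" "\<forall>\<^sub>F k in sequentially. r k \<le> M * q ^ k"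
      using geometric_bound[OF q(1) lin[OF half]] by blast
    \<comment> \<open>The distance is of the order of the square root of the gap, so the ratio
      becomes \<open>sqrt q\<close>.\<close>
    have "\<forall>\<^sub>F k in sequentially. norm (x k - xs) \<le> G * sqrt M * sqrt q ^ k"
      using M(2) xbound good
    proof eventually_elim
      case (elim k)
      have "r k powr (min (1 / 2) (1 - \<theta>)) = sqrt (r k)"
        using half elim by (simp add: powr_half_sqrt)
      also have "\<dots> \<le> sqrt (M * q ^ k)" using elim by simp
      also have "\<dots> = sqrt M * sqrt q ^ k" by (simp add: real_sqrt_mult real_sqrt_power)
      finally have "G * r k powr (min (1 / 2) (1 - \<theta>)) \<le> G * (sqrt M * sqrt q ^ k)"
        using G by (intro mult_left_mono) auto
      then show ?case using elim(2) by (simp add: mult.assoc)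
    qed
    then show ?thesis unfolding R_linear_def
      using xlim q M(1) G by (intro conjI exI[of _ "G * sqrt M"] exI[of _ "sqrt q"]) auto
  qed
  show r5: "\<exists>c>0. \<forall>k\<ge>1. r k \<le> c * real k powr (- (1 / (2 * \<theta> - 1)))" if "1/2 < \<theta>"
  proof -
    have "\<exists>c. \<forall>\<^sub>F k in sequentially. r k \<le> c * real k powr (- (1 / (2 * \<theta> - 1)))"
      \<comment> \<open>Here \<open>p = 2 * \<theta> - 1\<close>, so that \<open>1 + p\<close> is
        the exponent in \<open>rec\<close>.\<close>
      by (rule sublinear_rate[OF _ E]) (use that eventually_conj[OF rec good] in \<open>auto elim: eventually_mono\<close>)
    then show ?thesis using eventually_le_imp_all_le[where u = r] by fastforce
  qed
  show "\<exists>c>0. \<forall>k\<ge>1. norm (x k - xs) \<le> c * real k powr (- ((1 - \<theta>) / (2 * \<theta> - 1)))" if th: "1/2 < \<theta>"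
  proof -
    obtain c where c: "c > 0" "\<And>k. k \<ge> 1 \<Longrightarrow> r k \<le> c * real k powr (- (1 / (2 * \<theta> - 1)))"
      using r5[OF th] by blast
    have "\<forall>\<^sub>F k in sequentially. norm (x k - xs) \<le> G * c powr (1 - \<theta>) * real k powr (- ((1 - \<theta>) / (2 * \<theta> - 1)))"
      using xbound eventually_ge_at_top[of 1] good
    proof eventually_elim
      case (elim k)
      have "r k powr (1 - \<theta>) \<le> (c * real k powr (- (1 / (2 * \<theta> - 1)))) powr (1 - \<theta>)"
        using c elim \<open>\<theta> < 1\<close> by (intro powr_mono2) (auto simp: less_imp_le)
      also have "\<dots> = c powr (1 - \<theta>) * real k powr (- ((1 - \<theta>) / (2 * \<theta> - 1)))"
        using c by (simp add: powr_mult powr_powr)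
      finally have "G * r k powr (1 - \<theta>) \<le> G * (c powr (1 - \<theta>) * real k powr (- ((1 - \<theta>) / (2 * \<theta> - 1))))"
        using G by (intro mult_left_mono) auto
      moreover have m: "min (1 / 2) (1 - \<theta>) = 1 - \<theta>" using th by simp
      ultimately show ?case using elim(1)[unfolded m] by (simp only: mult.assoc)
    qed
    then show ?thesis by (rule eventually_le_imp_all_le) auto
  qed
qed

section \<open>Smooth functions and proximal steps\<close>

text \<open>As \<open>grad\<close> is a definite description, uniqueness is required: two gradients
  at one point induce the same functional, and testing it on their difference shows that they
  agree.\<close>

lemma C1_on_GDERIV:
  fixes f :: "'a::euclidean_space \<Rightarrow> ereal"
  assumes "C1_on U f" "z \<in> U"
  shows "GDERIV (\<lambda>y. real_of_ereal (f y)) z :> grad f z"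
proof -
  obtain d where d: "GDERIV (\<lambda>y. real_of_ereal (f y)) z :> d"
    using assms by (auto simp: C1_on_def)
  have "d' = d" if "GDERIV (\<lambda>y. real_of_ereal (f y)) z :> d'" for d'
  proof -
    have "(\<lambda>h. h \<bullet> d') = (\<lambda>h. h \<bullet> d)"
      using has_derivative_unique d that unfolding gderiv_def by blast
    then have "(d' - d) \<bullet> (d' - d) = 0"
      unfolding inner_diff_right by (metis diff_self)
    then show ?thesis by simp
  qed
  then show ?thesis unfolding grad_def using d by (metis (mono_tags, lifting) theI)
qed

text \<open>The mean value theorem on the segment, which convexity keeps inside \<open>S\<close>,
  gives the remainder with \<open>Lf\<close> in place of the sharp \<open>Lf / 2\<close>; the loss
  only affects constants.\<close>

lemma L_smooth_taylor:
  fixes f :: "'a::euclidean_space \<Rightarrow> ereal"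
  assumes smooth: "L_smooth_on Lf S f" and S: "convex S" "y \<in> S" "z \<in> S" and "Lf \<ge> 0"
  shows "\<bar>real_of_ereal (f z) - real_of_ereal (f y) - grad f y \<bullet> (z - y)\<bar> \<le> Lf * (norm (z - y))\<^sup>2"
proof -
  obtain U where U: "S \<subseteq> U" "C1_on U f" using smooth by (auto simp: L_smooth_on_def)
  define w where "w = (\<lambda>t::real. y + t *\<^sub>R (z - y))"
  have wS: "w t \<in> S" if "0 \<le> t" "t \<le> 1" for t
    using convexD_alt[OF S that] by (simp add: w_def algebra_simps)
  have "((\<lambda>t. real_of_ereal (f (w t))) has_real_derivative (z - y) \<bullet> grad f (w t)) (at t)"
    if "0 \<le> t" "t \<le> 1" for t
  proof -
    have "(w has_derivative (\<lambda>h. h *\<^sub>R (z - y))) (at t)"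
      unfolding w_def by (auto intro!: derivative_eq_intros)
    moreover have "((\<lambda>y. real_of_ereal (f y)) has_derivative (\<lambda>h. h \<bullet> grad f (w t))) (at (w t))"
      using C1_on_GDERIV[OF U(2)] wS[OF that] U(1) unfolding gderiv_def by blast
    ultimately have "((\<lambda>t. real_of_ereal (f (w t))) has_derivative (\<lambda>h. (h *\<^sub>R (z - y)) \<bullet> grad f (w t))) (at t)"
      by (rule has_derivative_compose)
    moreover have "(\<lambda>h. (h *\<^sub>R (z - y)) \<bullet> grad f (w t)) = (*) ((z - y) \<bullet> grad f (w t))"
      by (simp add: fun_eq_iff mult.commute)
    ultimately show ?thesis by (simp only: has_field_derivative_def)
  qed
  from MVT2[of 0 1, OF _ this] obtain t where t: "0 < t" "t < 1"
    "real_of_ereal (f (w 1)) - real_of_ereal (f (w 0)) = (z - y) \<bullet> grad f (w t)" by auto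
  then have "real_of_ereal (f z) - real_of_ereal (f y) - grad f y \<bullet> (z - y)
      = (grad f (w t) - grad f y) \<bullet> (z - y)"
    by (simp add: w_def algebra_simps inner_diff_left inner_diff_right inner_commute)
  also have "\<bar>\<dots>\<bar> \<le> norm (grad f (w t) - grad f y) * norm (z - y)"
    by (rule Cauchy_Schwarz_ineq2)
  also have "\<dots> \<le> (Lf * norm (z - y)) * norm (z - y)"
  proof (rule mult_right_mono)
    have "norm (grad f (w t) - grad f y) \<le> Lf * norm (w t - y)"
      using smooth wS[of t] t S by (auto simp: L_smooth_on_def)
    also have "norm (w t - y) = t * norm (z - y)" using t by (simp add: w_def)
    also have "Lf * (t * norm (z - y)) \<le> Lf * norm (z - y)"
      using t \<open>Lf \<ge> 0\<close> by (intro mult_left_mono mult_left_le_one_le) auto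
    finally show "norm (grad f (w t) - grad f y) \<le> Lf * norm (z - y)" .
  qed simp
  finally show ?thesis by (simp add: power2_eq_square mult_ac)
qed

section \<open>Proximal steps and their optimality condition\<close>

lemma proper_edom_ereal: "proper g \<Longrightarrow> z \<in> edom g \<Longrightarrow> g z = ereal (real_of_ereal (g z))"
  by (cases "g z") (auto simp: proper_def edom_def)

lemma prox_in_edom:
  assumes "proper g" "y \<in> prox g \<delta> u"
  shows "y \<in> edom g"
proof -
  obtain z where z: "z \<in> edom g" using assms by (auto simp: proper_def)
  have "g y + ereal (\<delta> / 2 * (norm (y - u))\<^sup>2) \<le> g z + ereal (\<delta> / 2 * (norm (z - u))\<^sup>2)"
    using assms(2) by (auto simp: prox_def is_arg_min_def not_less)
  also have "\<dots> < \<infinity>" using z by (auto simp: edom_def)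
  finally show ?thesis by (auto simp: edom_def)
qed

text \<open>Completing the square: the proximal objective at the shifted centre and the linearised
  model differ by a constant, which cancels in the comparison.\<close>

lemma prox_step_ineq:
  assumes "proper g" "\<delta> > 0" "y \<in> prox g \<delta> (u - (1 / \<delta>) *\<^sub>R v)" "z \<in> edom g"
  shows "real_of_ereal (g y) + v \<bullet> (y - u) + \<delta> / 2 * (norm (y - u))\<^sup>2
       \<le> real_of_ereal (g z) + v \<bullet> (z - u) + \<delta> / 2 * (norm (z - u))\<^sup>2"
proof -
  let ?u = "u - (1 / \<delta>) *\<^sub>R v"
  have sq: "\<delta> / 2 * (norm (w - ?u))\<^sup>2 = \<delta> / 2 * (norm (w - u))\<^sup>2 + v \<bullet> (w - u) + (norm v)\<^sup>2 / (2 * \<delta>)" for w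
  proof -
    have "(norm (w - ?u))\<^sup>2 = (norm ((w - u) + (1 / \<delta>) *\<^sub>R v))\<^sup>2" by (simp add: algebra_simps)
    also have "\<dots> = (norm (w - u))\<^sup>2 + 2 * ((1 / \<delta>) * ((w - u) \<bullet> v)) + (norm v)\<^sup>2 / \<delta>\<^sup>2"
      using dot_norm[of "w - u" "(1 / \<delta>) *\<^sub>R v"] by (simp add: power_divide field_simps)
    finally show ?thesis
      using \<open>\<delta> > 0\<close> by (simp add: inner_commute field_simps power2_eq_square)
  qed
  have "g y + ereal (\<delta> / 2 * (norm (y - ?u))\<^sup>2) \<le> g z + ereal (\<delta> / 2 * (norm (z - ?u))\<^sup>2)"
    using assms(3) by (auto simp: prox_def is_arg_min_def not_less)
  moreover have "g y = ereal (real_of_ereal (g y))" "g z = ereal (real_of_ereal (g z))"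
    by (rule proper_edom_ereal[OF assms(1) prox_in_edom[OF assms(1,3)]],
        rule proper_edom_ereal[OF assms(1,4)])
  ultimately have "real_of_ereal (g y) + \<delta> / 2 * (norm (y - ?u))\<^sup>2
      \<le> real_of_ereal (g z) + \<delta> / 2 * (norm (z - ?u))\<^sup>2"
    by (metis ereal_less_eq(3) plus_ereal.simps(1))
  then show ?thesis by (simp only: sq)
qed

text \<open>First-order optimality without convexity: minimality of \<open>y\<close> bounds
  \<open>g\<close> from below by an affine function up to a quadratic error in \<open>z - y\<close>,
  and differentiability of \<open>f\<close> adds another error of order
  \<open>o(norm (z - y))\<close>.\<close>

lemma frechet_subdiff_prox_step:
  fixes f g F :: "'a::euclidean_space \<Rightarrow> ereal"
  assumes F: "\<And>z. F z = f z + g z" and f: "open U" "C1_on U f" and g: "proper g"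
    and y: "y \<in> U" "y \<in> edom g" and "\<delta> > 0"
    and opt: "\<And>z. z \<in> edom g \<Longrightarrow> real_of_ereal (g y) + v \<bullet> (y - u) + \<delta> / 2 * (norm (y - u))\<^sup>2
       \<le> real_of_ereal (g z) + v \<bullet> (z - u) + \<delta> / 2 * (norm (z - u))\<^sup>2"
  shows "grad f y - v - \<delta> *\<^sub>R (y - u) \<in> frechet_subdiff F y"
proof -
  let ?f = "\<lambda>z. real_of_ereal (f z)" and ?g = "\<lambda>z. real_of_ereal (g z)"
  define \<xi> where "\<xi> = grad f y - v - \<delta> *\<^sub>R (y - u)"
  have fr: "f z = ereal (?f z)" if "z \<in> U" for z
    using f that by (auto simp: C1_on_def ereal_real)
  have gr: "g z = ereal (?g z)" if "z \<in> edom g" for z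
    using proper_edom_ereal[OF g that] .
  have Fy: "F y = ereal (?f y + ?g y)" by (metis F fr gr y plus_ereal.simps(1))
  have "0 \<le> Liminf (at y) (\<lambda>z. (F z - F y - ereal (\<xi> \<bullet> (z - y))) / ereal (norm (z - y)))"
    unfolding le_Liminf_iff
  proof (intro allI impI)
    fix c :: ereal assume "c < 0"
    then obtain e where e: "c < ereal e" "ereal e < 0" using ereal_dense2 by blast
    \<comment> \<open>The slack \<open>- e\<close> is split evenly between the remainder of
      \<open>f\<close> and the quadratic term.\<close>
    define \<epsilon> where "\<epsilon> = - e / 2"
    have eps: "\<epsilon> > 0" "e = - 2 * \<epsilon>" using e by (auto simp: \<epsilon>_def)
    have "(?f has_derivative (\<lambda>h. h \<bullet> grad f y)) (at y)"
      using C1_on_GDERIV[OF f(2) y(1)] by (simp add: gderiv_def)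
    then obtain d where d: "d > 0"
      "\<And>z. norm (z - y) < d \<Longrightarrow> norm (?f z - ?f y - (z - y) \<bullet> grad f y) \<le> \<epsilon> * norm (z - y)"
      using eps unfolding has_derivative_at_alt by meson
    have "\<forall>\<^sub>F z in at y. z \<in> U" using f y by (simp add: eventually_at_in_open')
    \<comment> \<open>Within radius \<open>2 * \<epsilon> / \<delta>\<close> the quadratic term is
      at most \<open>\<epsilon> * norm (z - y)\<close>.\<close>
    moreover have "\<forall>\<^sub>F z in at y. z \<in> ball y (min d (2 * \<epsilon> / \<delta>))"
      using d eps \<open>\<delta> > 0\<close> by (intro eventually_at_in_open') auto
    moreover have "\<forall>\<^sub>F z in at y. z \<noteq> y" by (simp add: eventually_neq_at_within)
    ultimately show "\<forall>\<^sub>F z in at y. c < (F z - F y - ereal (\<xi> \<bullet> (z - y))) / ereal (norm (z - y))"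
    proof eventually_elim
      case (elim z)
      define n where "n = norm (z - y)"
      have n: "n > 0" "n < d" "\<delta> * n \<le> 2 * \<epsilon>"
        using elim \<open>\<delta> > 0\<close> by (auto simp: n_def dist_norm norm_minus_commute field_simps)
      show ?case
      proof (cases "z \<in> edom g")
        case True
        let ?q = "?f z + ?g z - (?f y + ?g y) - \<xi> \<bullet> (z - y)"
        have Fz: "F z = ereal (?f z + ?g z)" by (metis F fr gr elim(1) True plus_ereal.simps(1))
        have "(norm (z - u))\<^sup>2 = n\<^sup>2 + 2 * ((z - y) \<bullet> (y - u)) + (norm (y - u))\<^sup>2"
          using dot_norm[of "z - y" "y - u"] by (simp add: n_def)
        then have "\<delta> / 2 * (norm (z - u))\<^sup>2 = \<delta> / 2 * n\<^sup>2 + \<delta> * ((z - y) \<bullet> (y - u)) + \<delta> / 2 * (norm (y - u))\<^sup>2"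
          by (simp only: distrib_left)
        then have "?g z - ?g y \<ge> v \<bullet> (y - u) - v \<bullet> (z - u) - \<delta> / 2 * n\<^sup>2 - \<delta> * ((z - y) \<bullet> (y - u))"
          using opt[OF True] by linarith
        moreover have "?f z - ?f y \<ge> (z - y) \<bullet> grad f y - \<epsilon> * n"
          using d(2)[of z] n unfolding n_def by (simp add: abs_le_iff)
        moreover have "\<xi> \<bullet> (z - y) = (z - y) \<bullet> grad f y + (v \<bullet> (y - u) - v \<bullet> (z - u)) - \<delta> * ((z - y) \<bullet> (y - u))"
          by (simp add: \<xi>_def inner_diff_left inner_diff_right inner_commute algebra_simps)
        ultimately have "?q \<ge> - \<epsilon> * n - \<delta> / 2 * n\<^sup>2" by linarith
        moreover have "\<delta> / 2 * n\<^sup>2 \<le> \<epsilon> * n"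
          using mult_right_mono[OF n(3), of n] n(1) by (simp add: power2_eq_square)
        ultimately have "?q \<ge> e * n" using eps by (simp add: algebra_simps)
        then have "e \<le> ?q / n" using n by (simp add: pos_le_divide_eq)
        then have "ereal e \<le> (F z - F y - ereal (\<xi> \<bullet> (z - y))) / ereal n"
          using n by (simp add: Fz Fy)
        then show ?thesis using e(1) unfolding n_def by (rule less_le_trans[rotated])
      next
        case False
        \<comment> \<open>Off the domain of \<open>g\<close> the quotient is infinite, since
          \<open>f\<close> is finite on \<open>U\<close>.\<close>
        then have "F z = \<infinity>" using F[of z] fr[OF elim(1)] by (auto simp: edom_def)
        then have "(F z - F y - ereal (\<xi> \<bullet> (z - y))) / ereal n = \<infinity>"
          using n by (simp add: Fy divide_ereal_def)
        then show ?thesis using \<open>c < 0\<close> unfolding n_def by auto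
      qed
    qed
  qed
  then show ?thesis by (simp add: frechet_subdiff_def edom_def Fy flip: \<xi>_def)
qed

section \<open>Limiting subgradients and lower semicontinuity along sequences\<close>

lemma frechet_subset_limiting_subdiff: "frechet_subdiff F z \<subseteq> limiting_subdiff F z"
proof
  fix \<xi> assume *: "\<xi> \<in> frechet_subdiff F z"
  then have "z \<in> edom F" by (auto simp: frechet_subdiff_def split: if_splits)
  then show "\<xi> \<in> limiting_subdiff F z"
    using * unfolding limiting_subdiff_def
    by (simp, intro exI[of _ "\<lambda>_. z"], simp, intro exI[of _ "\<lambda>_. \<xi>"], simp)
qed

lemma lsc_limit_le:
  fixes \<phi> :: "'a::topological_space \<Rightarrow> ereal" and c :: real
  assumes "lsc \<phi>" "y \<longlonglongrightarrow> z" "u \<longlonglongrightarrow> c" "\<And>j. \<phi> (y j) \<le> ereal (u j)"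
  shows "\<phi> z \<le> ereal c"
proof (rule ccontr)
  assume "\<not> \<phi> z \<le> ereal c"
  then have "ereal c < \<phi> z" by simp
  from ereal_dense2[OF this] obtain c' where c': "ereal c < ereal c'" "ereal c' < \<phi> z" by blast
  have "\<phi> z \<le> Liminf (at z) \<phi>" using assms(1) by (simp add: lsc_def)
  then have "\<forall>\<^sub>F w in at z. ereal c' < \<phi> w" using c'(2) unfolding le_Liminf_iff by blast
  \<comment> \<open>The lower limit ignores \<open>z\<close> itself; adding the value there allows
    the sequence to hit its limit.\<close>
  then have "\<forall>\<^sub>F w in nhds z. ereal c' < \<phi> w"
    unfolding eventually_at_filter by (rule eventually_mono) (use c'(2) in auto)
  then have "\<forall>\<^sub>F j in sequentially. ereal c' < \<phi> (y j)"
    using assms(2) unfolding filterlim_iff by blast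
  moreover have "\<forall>\<^sub>F j in sequentially. u j < c'"
    using order_tendstoD(2)[OF assms(3)] c'(1) by simp
  ultimately have "\<forall>\<^sub>F j in sequentially. False"
  proof eventually_elim
    case (elim j)
    have "ereal c' < ereal (u j)" using elim(1) assms(4)[of j] by (rule less_le_trans)
    then show ?case using elim(2) by simp
  qed
  then show False by simp
qed

section \<open>The auto-conditioned proximal gradient method\<close>

locale ac_pgm_run =
  fixes f g F :: "'a::euclidean_space \<Rightarrow> ereal"
    and Lf \<alpha> :: real and L \<gamma> :: "nat \<Rightarrow> real" and x :: "nat \<Rightarrow> 'a"
  assumes proper_g: "proper g" and lsc_g: "lsc g"
    and F_eq: "\<And>z. F z = f z + g z" and F_bdd: "(INF z. F z) > -\<infinity>"
    and Lf: "Lf > 0" and smooth: "L_smooth_on Lf (convex hull (edom g)) f"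
    and run: "ac_pgm f g \<alpha> L \<gamma> x" and moves: "\<And>k. x (Suc k) \<noteq> x k"
begin

abbreviation "fr z \<equiv> real_of_ereal (f z)"
abbreviation "gr z \<equiv> real_of_ereal (g z)"
text \<open>The objective value at \<open>x k\<close> as a real number, legitimate because the
  iterates stay in the domain of \<open>g\<close>.\<close>

abbreviation "R k \<equiv> fr (x k) + gr (x k)"
abbreviation "d k \<equiv> norm (x (Suc k) - x k)"

lemma alpha: "\<alpha> > 1" and L0: "L 0 > 0"
  using run by (auto simp: ac_pgm_def)

lemma gamma_Suc: "\<gamma> (Suc k) = Max (L ` {0..k})"
  using run by (auto simp: ac_pgm_def)

lemma x_Suc: "x (Suc k) \<in> prox g (\<alpha> * \<gamma> (Suc k)) (x k - (1 / (\<alpha> * \<gamma> (Suc k))) *\<^sub>R grad f (x k))"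
  using run by (auto simp: ac_pgm_def dest!: spec[of _ "Suc k"])

text \<open>The definition of \<open>L (Suc k)\<close> solved for \<open>f\<close>; distinct
  iterates keep its denominator nonzero. This is an exact expansion rather than a descent
  inequality.\<close>

lemma f_Suc: "fr (x (Suc k)) = fr (x k) + grad f (x k) \<bullet> (x (Suc k) - x k) + L (Suc k) / 2 * (d k)\<^sup>2"
proof -
  have "L (Suc k) = 2 * (fr (x (Suc k)) - fr (x k) - grad f (x k) \<bullet> (x (Suc k) - x k)) / (d k)\<^sup>2"
    using run by (auto simp: ac_pgm_def dest!: spec[of _ "Suc k"])
  moreover have "d k \<noteq> 0" using moves by simp
  ultimately show ?thesis by (simp add: field_simps)
qed

lemma x_edom: "x k \<in> edom g"
  using run prox_in_edom[OF proper_g x_Suc] by (cases k) (auto simp: ac_pgm_def)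

lemma edom_hull: "z \<in> edom g \<Longrightarrow> z \<in> convex hull (edom g)"
  by (rule hull_inc)

lemma taylor:
  assumes "y \<in> edom g" "z \<in> edom g"
  shows "\<bar>fr z - fr y - grad f y \<bullet> (z - y)\<bar> \<le> Lf * (norm (z - y))\<^sup>2"
  using L_smooth_taylor[OF smooth convex_convex_hull edom_hull[OF assms(1)] edom_hull[OF assms(2)]] Lf by simp

lemma grad_lipschitz:
  assumes "y \<in> edom g" "z \<in> edom g"
  shows "norm (grad f y - grad f z) \<le> Lf * norm (y - z)"
  using smooth edom_hull assms by (auto simp: L_smooth_on_def)

lemma smooth_nbhd:
  obtains U where "open U" "edom g \<subseteq> U" "C1_on U f"
  using smooth edom_hull unfolding L_smooth_on_def by blast

lemma F_edom:
  assumes "z \<in> edom g"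
  shows "F z = ereal (fr z + gr z)"
proof -
  obtain U where U: "edom g \<subseteq> U" "C1_on U f" using smooth_nbhd by blast
  have "z \<in> U" using U(1) assms by (rule subsetD)
  then have "\<bar>f z\<bar> \<noteq> \<infinity>" using U(2) by (simp add: C1_on_def)
  then have "f z = ereal (fr z)"
    by (simp only: ereal_real if_False)
  then show ?thesis
    using F_eq[of z] proper_edom_ereal[OF proper_g assms] by (metis plus_ereal.simps(1))
qed

lemma f_tendsto:
  assumes "z \<in> edom g" "(y \<longlongrightarrow> z) net"
  shows "((\<lambda>j. fr (y j)) \<longlongrightarrow> fr z) net"
proof -
  obtain U where U: "edom g \<subseteq> U" "C1_on U f" using smooth_nbhd by blast
  then have "(fr has_derivative (\<lambda>h. h \<bullet> grad f z)) (at z)"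
    using C1_on_GDERIV[OF U(2)] assms(1) unfolding gderiv_def by blast
  then have "isCont fr z" by (rule has_derivative_continuous)
  then show ?thesis using assms(2) isCont_tendsto_compose by blast
qed

section \<open>Bounds on the step parameters and sufficient decrease\<close>

lemma L_le_gamma: "L k \<le> \<gamma> (Suc k)"
  unfolding gamma_Suc by (rule Max_ge) auto

lemma gamma_mono: "\<gamma> (Suc k) \<le> \<gamma> (Suc (Suc k))"
  unfolding gamma_Suc by (rule Max_mono) auto

lemma gamma_ge: "L 0 \<le> \<gamma> (Suc k)"
  unfolding gamma_Suc by (rule Max_ge) auto

lemma gamma_pos: "\<gamma> (Suc k) > 0"
  using gamma_ge[of k] L0 by linarith

lemma L_le: "L (Suc k) \<le> 2 * Lf"
proof -
  have "L (Suc k) / 2 * (d k)\<^sup>2 \<le> Lf * (d k)\<^sup>2"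
    using taylor[OF x_edom x_edom, of "Suc k" k] f_Suc[of k] by simp
  then show ?thesis using moves[of k] by simp
qed

lemma gamma_le: "\<gamma> (Suc k) \<le> max (L 0) (2 * Lf)"
proof -
  have "L j \<le> max (L 0) (2 * Lf)" for j
    using L_le by (cases j) (auto simp: le_max_iff_disj)
  then show ?thesis unfolding gamma_Suc by (intro Max.boundedI) auto
qed

text \<open>By \<open>f_Suc\<close> the linear term at the new iterate becomes a difference of
  values of \<open>f\<close>, so the gain is governed by
  \<open>\<alpha> * \<gamma> (Suc k) - L (Suc k)\<close>, whose sign is not yet known.\<close>

lemma step_ineq:
  assumes "z \<in> edom g"
  shows "R (Suc k) + (\<alpha> * \<gamma> (Suc k) - L (Suc k)) / 2 * (d k)\<^sup>2
       \<le> fr (x k) + gr z + grad f (x k) \<bullet> (z - x k) + \<alpha> * \<gamma> (Suc k) / 2 * (norm (z - x k))\<^sup>2"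
  using prox_step_ineq[OF proper_g _ x_Suc[of k] assms] f_Suc[of k] alpha gamma_pos[of k]
  by (simp add: algebra_simps diff_divide_distrib)

text \<open>Since \<open>L (Suc k) \<le> \<gamma> (Suc (Suc k))\<close>, the slack is at least
  \<open>(\<alpha> - 1) * \<gamma> (Suc k)\<close> minus an increment of \<open>\<gamma>\<close>.
  The first term is at least \<open>2 * \<epsilon>\<close>, and the increments tend to 0 because
  \<open>\<gamma>\<close> is monotone and bounded.\<close>

lemma eventually_slack:
  "\<forall>\<^sub>F k in sequentially. (\<alpha> - 1) * L 0 / 2 \<le> \<alpha> * \<gamma> (Suc k) - L (Suc k)"
proof -
  define \<epsilon> where "\<epsilon> = (\<alpha> - 1) * L 0 / 2"
  have eps: "\<epsilon> > 0" using alpha L0 by (simp add: \<epsilon>_def)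
  obtain l where l: "(\<lambda>k. \<gamma> (Suc k)) \<longlonglongrightarrow> l"
    using incseq_convergent[of "\<lambda>k. \<gamma> (Suc k)" "max (L 0) (2 * Lf)"] gamma_mono gamma_le
    by (metis incseq_SucI)
  have "(\<lambda>k. \<gamma> (Suc (Suc k)) - \<gamma> (Suc k)) \<longlonglongrightarrow> l - l"
    by (intro tendsto_diff l LIMSEQ_Suc[OF l])
  then have "\<forall>\<^sub>F k in sequentially. \<gamma> (Suc (Suc k)) - \<gamma> (Suc k) < \<epsilon>"
    using order_tendstoD(2) eps by fastforce
  then show ?thesis
  proof eventually_elim
    case (elim k)
    have "(\<alpha> - 1) * L 0 \<le> (\<alpha> - 1) * \<gamma> (Suc k)"
      using gamma_ge alpha by (intro mult_left_mono) auto
    moreover have "(\<alpha> - 1) * \<gamma> (Suc k) = \<alpha> * \<gamma> (Suc k) - \<gamma> (Suc k)" by (simp add: algebra_simps)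
    moreover have "(\<alpha> - 1) * L 0 = 2 * \<epsilon>" by (simp add: \<epsilon>_def)
    ultimately show ?case using elim L_le_gamma[of "Suc k"] unfolding \<epsilon>_def[symmetric] by linarith
  qed
qed

text \<open>Half of the eventual slack, as \<open>step_ineq\<close> carries the slack with a factor
  \<open>1 / 2\<close>.\<close>

definition "descent_const = (\<alpha> - 1) * L 0 / 4"
text \<open>The Lipschitz constant of the gradient plus the largest possible proximal weight
  \<open>\<alpha> * \<gamma> (Suc k)\<close>.\<close>

definition "subgrad_const = Lf + \<alpha> * max (L 0) (2 * Lf)"

lemma descent_const_pos: "descent_const > 0"
  using alpha L0 by (simp add: descent_const_def)

lemma subgrad_const_pos: "subgrad_const > 0"
  using alpha L0 Lf by (simp add: subgrad_const_def add_pos_pos less_max_iff_disj)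

text \<open>The comparison point stays free: \<open>z = x k\<close> gives monotonicity, a cluster
  point gives the gap estimate. The index from which the bound holds is the same for all
  \<open>z\<close>.\<close>

lemma descent:
  "\<forall>\<^sub>F k in sequentially. \<forall>z\<in>edom g.
     R (Suc k) + descent_const * (d k)\<^sup>2 \<le> fr (x k) + gr z + grad f (x k) \<bullet> (z - x k)
       + \<alpha> * \<gamma> (Suc k) / 2 * (norm (z - x k))\<^sup>2"
  using eventually_slack
proof eventually_elim
  case (elim k)
  have "descent_const * (d k)\<^sup>2 \<le> (\<alpha> * \<gamma> (Suc k) - L (Suc k)) / 2 * (d k)\<^sup>2"
    using elim by (intro mult_right_mono) (auto simp: descent_const_def field_simps)
  then show ?case using step_ineq[of _ k] by fastforce
qed

text \<open>The step linearises \<open>f\<close> at \<open>x k\<close>, so its optimality condition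
  at \<open>x (Suc k)\<close> leaves a gradient difference and the proximal term, both linear in
  \<open>d k\<close>.\<close>

lemma subgradient:
  "\<exists>\<xi>\<in>frechet_subdiff F (x (Suc k)). norm \<xi> \<le> subgrad_const * d k"
proof
  let ?\<delta> = "\<alpha> * \<gamma> (Suc k)"
  let ?\<xi> = "grad f (x (Suc k)) - grad f (x k) - ?\<delta> *\<^sub>R (x (Suc k) - x k)"
  have pos: "?\<delta> > 0" using alpha gamma_pos by simp
  obtain U where U: "open U" "edom g \<subseteq> U" "C1_on U f" by (rule smooth_nbhd)
  show "?\<xi> \<in> frechet_subdiff F (x (Suc k))"
    using frechet_subdiff_prox_step[OF F_eq U(1,3) proper_g _ x_edom pos prox_step_ineq[OF proper_g pos x_Suc]]
      U(2) x_edom by blast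
  have "norm ?\<xi> \<le> norm (grad f (x (Suc k)) - grad f (x k)) + norm (?\<delta> *\<^sub>R (x (Suc k) - x k))"
    by (rule norm_triangle_ineq4)
  also have "\<dots> \<le> Lf * d k + ?\<delta> * d k"
    using grad_lipschitz[OF x_edom x_edom, of "Suc k" k] pos by simp
  also have "\<dots> \<le> subgrad_const * d k"
    using alpha gamma_le[of k] unfolding subgrad_const_def distrib_right
    by (intro add_left_mono mult_right_mono mult_left_mono) auto
  finally show "norm ?\<xi> \<le> subgrad_const * d k" .
qed

section \<open>Convergence of the objective values\<close>

lemma R_bdd: "\<exists>B. \<forall>k. B \<le> R k"
proof (cases "INF z. F z")
  case (real B)
  have "ereal B \<le> F (x k)" for k
    unfolding real[symmetric] by (rule INF_lower) simp
  then show ?thesis unfolding F_edom[OF x_edom] by auto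
next
  case PInf
  have "(INF z. F z) \<le> F (x 0)" by (rule INF_lower) simp
  then show ?thesis using PInf F_edom[OF x_edom] by simp
qed (use F_bdd in simp)

lemma eventually_descent:
  "\<forall>\<^sub>F k in sequentially. descent_const * (d k)\<^sup>2 \<le> R k - R (Suc k)"
  using descent
proof eventually_elim
  case (elim k)
  show ?case using elim[rule_format, OF x_edom, of k] by simp
qed

lemma R_convergent: "convergent (\<lambda>k. R k)"
proof -
  obtain K where K: "\<And>k. k \<ge> K \<Longrightarrow> descent_const * (d k)\<^sup>2 \<le> R k - R (Suc k)"
    using eventually_descent unfolding eventually_sequentially by blast
  obtain B where B: "\<And>k. B \<le> R k" using R_bdd by blast
  \<comment> \<open>Early steps may increase the objective, so only a shifted sequence is
    monotone.\<close>
  have "decseq (\<lambda>k. R (k + K))"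
  proof (rule decseq_SucI)
    fix k
    have "0 \<le> descent_const * (d (k + K))\<^sup>2" using descent_const_pos by simp
    then show "R (Suc k + K) \<le> R (k + K)" using K[of "k + K"] by simp
  qed
  then obtain l where "(\<lambda>k. R (k + K)) \<longlonglongrightarrow> l"
    using decseq_convergent[of "\<lambda>k. R (k + K)" B] B by blast
  then have "convergent (\<lambda>k. R (k + K))" by (rule convergentI)
  then show ?thesis using convergent_ignore_initial_segment[of "\<lambda>k. R k" K] by simp
qed

lemma d_tendsto_0: "d \<longlonglongrightarrow> 0"
proof -
  obtain l where "(\<lambda>k. R k) \<longlonglongrightarrow> l" using R_convergent by (auto simp: convergent_def)
  from steps_tendsto_0[OF descent_const_pos this _ eventually_descent] show ?thesis by simp
qed

section \<open>Cluster points of the iterates\<close>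

context
  fixes s xs assumes sub: "strict_mono s" "(x \<circ> s) \<longlonglongrightarrow> xs"
begin

text \<open>Along the iterates \<open>g\<close> is \<open>R - f\<close>, hence at most
  \<open>R - h\<close>, and lower semicontinuity passes to the limit. The minorant \<open>h\<close>
  is kept general because \<open>f\<close> itself is usable only once \<open>xs\<close> is known to
  lie in the domain of \<open>g\<close>.\<close>

lemma cluster_lsc:
  assumes h: "(\<lambda>j. h (x (s j))) \<longlonglongrightarrow> c" "\<And>k. h (x k) \<le> fr (x k)" and R: "(\<lambda>k. R k) \<longlonglongrightarrow> l"
  shows "g xs \<le> ereal (l - c)"
proof (rule lsc_limit_le[OF lsc_g])
  show "(\<lambda>j. x (s j)) \<longlonglongrightarrow> xs" using sub(2) by (simp add: o_def)
  show "(\<lambda>j. R (s j) - h (x (s j))) \<longlonglongrightarrow> l - c"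
    using LIMSEQ_subseq_LIMSEQ[OF R sub(1)] h(1) by (intro tendsto_diff) (auto simp: o_def)
  show "g (x (s j)) \<le> ereal (R (s j) - h (x (s j)))" for j
    using h(2)[of "s j"] by (subst proper_edom_ereal[OF proper_g x_edom]) simp
qed

lemma cluster_edom: "xs \<in> edom g"
proof -
  \<comment> \<open>The quadratic lower Taylor bound of \<open>f\<close> at \<open>x 0\<close>,
    continuous on the whole space.\<close>
  let ?h = "\<lambda>z. fr (x 0) + grad f (x 0) \<bullet> (z - x 0) - Lf * (norm (z - x 0))\<^sup>2"
  obtain l where l: "(\<lambda>k. R k) \<longlonglongrightarrow> l" using R_convergent by (auto simp: convergent_def)
  have "(\<lambda>j. x (s j)) \<longlonglongrightarrow> xs" using sub(2) by (simp add: o_def)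
  then have "(\<lambda>j. ?h (x (s j))) \<longlonglongrightarrow> ?h xs" by (intro tendsto_intros)
  moreover have "?h (x k) \<le> fr (x k)" for k
    using taylor[OF x_edom x_edom, of k 0] by (simp add: abs_le_iff)
  ultimately have "g xs \<le> ereal (l - ?h xs)" using l by (rule cluster_lsc)
  then show ?thesis by (auto simp: edom_def)
qed

text \<open>Take \<open>xs\<close> as comparison point; the linearisation of \<open>f\<close> at
  \<open>x k\<close> exceeds \<open>f xs\<close> by at most a quadratic term.\<close>

lemma eventually_gap_le:
  "\<forall>\<^sub>F k in sequentially. R (Suc k) + descent_const * (d k)\<^sup>2
     \<le> fr xs + gr xs + subgrad_const * (norm (x k - xs))\<^sup>2"
  using descent
proof eventually_elim
  case (elim k)
  have "fr (x k) + grad f (x k) \<bullet> (xs - x k) \<le> fr xs + Lf * (norm (xs - x k))\<^sup>2"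
    using taylor[OF x_edom cluster_edom, of k] by (simp add: abs_le_iff)
  moreover have "Lf * (norm (xs - x k))\<^sup>2 + \<alpha> * \<gamma> (Suc k) / 2 * (norm (xs - x k))\<^sup>2
      \<le> subgrad_const * (norm (xs - x k))\<^sup>2"
  proof -
    have "\<alpha> * \<gamma> (Suc k) / 2 \<le> \<alpha> * \<gamma> (Suc k)" using alpha gamma_pos[of k] by simp
    also have "\<dots> \<le> \<alpha> * max (L 0) (2 * Lf)" using alpha gamma_le by (intro mult_left_mono) auto
    finally show ?thesis
      unfolding subgrad_const_def distrib_right by (intro add_left_mono mult_right_mono) auto
  qed
  ultimately show ?case
    using elim[rule_format, OF cluster_edom] by (simp add: norm_minus_commute)
qed

text \<open>Lower semicontinuity bounds the limit from below. As \<open>g\<close> need not be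
  continuous, the bound from above comes from \<open>eventually_gap_le\<close> along the
  subsequence.\<close>

lemma R_tendsto: "(\<lambda>k. R k) \<longlonglongrightarrow> fr xs + gr xs"
proof -
  obtain l where l: "(\<lambda>k. R k) \<longlonglongrightarrow> l" using R_convergent by (auto simp: convergent_def)
  have x: "(\<lambda>j. x (s j)) \<longlonglongrightarrow> xs" using sub(2) by (simp add: o_def)
  have "g xs \<le> ereal (l - fr xs)"
    by (rule cluster_lsc[OF f_tendsto[OF cluster_edom x] order_refl l])
  then have 1: "fr xs + gr xs \<le> l"
    by (subst (asm) proper_edom_ereal[OF proper_g cluster_edom]) simp
  have "(\<lambda>k. R (Suc k)) \<longlonglongrightarrow> l" using l by (rule LIMSEQ_Suc)
  from LIMSEQ_subseq_LIMSEQ[OF this sub(1)] have a: "(\<lambda>j. R (Suc (s j))) \<longlonglongrightarrow> l" by (simp add: o_def)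
  have "(\<lambda>j. fr xs + gr xs + subgrad_const * (norm (x (s j) - xs))\<^sup>2)
      \<longlonglongrightarrow> fr xs + gr xs + subgrad_const * (norm (xs - xs))\<^sup>2"
    using x by (intro tendsto_intros)
  then have b: "(\<lambda>j. fr xs + gr xs + subgrad_const * (norm (x (s j) - xs))\<^sup>2) \<longlonglongrightarrow> fr xs + gr xs"
    by simp
  have "\<forall>\<^sub>F k in sequentially. R (Suc k) \<le> fr xs + gr xs + subgrad_const * (norm (x k - xs))\<^sup>2"
    using eventually_gap_le
  proof eventually_elim
    case (elim k)
    have "0 \<le> descent_const * (d k)\<^sup>2" using descent_const_pos by simp
    then show ?case using elim by linarith
  qed
  then have "\<forall>\<^sub>F j in sequentially. R (Suc (s j)) \<le> fr xs + gr xs + subgrad_const * (norm (x (s j) - xs))\<^sup>2"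
    using filterlim_subseq[OF sub(1)] unfolding filterlim_iff by blast
  then have "l \<le> fr xs + gr xs" by (rule tendsto_le[OF trivial_limit_sequentially b a])
  then show ?thesis using 1 l by simp
qed

text \<open>The KL hypothesis applies at \<open>xs\<close> since 0 is a limiting subgradient there.
  The witnesses are the successors \<open>x (Suc (s j))\<close>, where small subgradients are
  available; vanishing steps give them the same limit.\<close>

lemma cluster_dom_subdiff: "xs \<in> dom_subdiff F"
proof -
  obtain \<xi> where \<xi>: "\<And>k. \<xi> k \<in> frechet_subdiff F (x (Suc k))" "\<And>k. norm (\<xi> k) \<le> subgrad_const * d k"
    using subgradient by metis
  have xi0: "\<xi> \<longlonglongrightarrow> 0"
    by (rule Lim_null_comparison[OF always_eventually tendsto_mult_right_zero[OF d_tendsto_0]])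
      (use \<xi>(2) in blast)
  have x: "(\<lambda>j. x (s j)) \<longlonglongrightarrow> xs" using sub(2) by (simp add: o_def)
  have "(\<lambda>k. x (Suc k) - x k) \<longlonglongrightarrow> 0" using d_tendsto_0 by (simp add: tendsto_norm_zero_iff)
  from LIMSEQ_subseq_LIMSEQ[OF this sub(1)] have "(\<lambda>j. x (Suc (s j)) - x (s j)) \<longlonglongrightarrow> 0" by (simp add: o_def)
  from tendsto_add[OF this x] have X: "(\<lambda>j. x (Suc (s j))) \<longlonglongrightarrow> xs" by simp
  have "(\<lambda>j. R (Suc (s j))) \<longlonglongrightarrow> fr xs + gr xs"
    using LIMSEQ_subseq_LIMSEQ[OF LIMSEQ_Suc[OF R_tendsto] sub(1)] by (simp add: o_def)
  then have "(\<lambda>j. F (x (Suc (s j)))) \<longlonglongrightarrow> F xs"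
    unfolding F_edom[OF x_edom] F_edom[OF cluster_edom] by (rule tendsto_ereal)
  moreover have "(\<lambda>j. \<xi> (s j)) \<longlonglongrightarrow> 0"
    using LIMSEQ_subseq_LIMSEQ[OF xi0 sub(1)] by (simp add: o_def)
  ultimately have "\<exists>X \<Xi>. X \<longlonglongrightarrow> xs \<and> (\<lambda>k. F (X k)) \<longlonglongrightarrow> F xs \<and> \<Xi> \<longlonglongrightarrow> 0 \<and>
      (\<forall>k::nat. \<Xi> k \<in> frechet_subdiff F (X k))"
    using X \<xi>(1) by (intro exI[of _ "\<lambda>j. x (Suc (s j))"] exI[of _ "\<lambda>j. \<xi> (s j)"]) auto
  moreover have "xs \<in> edom F" using F_edom[OF cluster_edom] by (simp add: edom_def)
  ultimately have "0 \<in> limiting_subdiff F xs"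
    by (simp add: limiting_subdiff_def)
  then show ?thesis by (auto simp: dom_subdiff_def)
qed

section \<open>The objective gap and its KL inequality\<close>

abbreviation "gap k \<equiv> R k - (fr xs + gr xs)"

lemma F_gap: "F (x k) - F xs = ereal (gap k)"
  unfolding F_edom[OF x_edom] F_edom[OF cluster_edom] by simp

lemma gap_tendsto: "gap \<longlonglongrightarrow> 0"
  using tendsto_diff[OF R_tendsto tendsto_const[of "fr xs + gr xs"]] by simp

lemma eventually_gap:
  "\<forall>\<^sub>F k in sequentially. 0 < gap (Suc k) \<and> gap (Suc k) < gap k \<and>
     descent_const * (d k)\<^sup>2 \<le> gap k - gap (Suc k) \<and>
     d k \<le> sqrt (subgrad_const / descent_const) * norm (x k - xs)"
proof -
  obtain K where K: "\<And>k. k \<ge> K \<Longrightarrow> descent_const * (d k)\<^sup>2 \<le> R k - R (Suc k)"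
    using eventually_descent unfolding eventually_sequentially by blast
  have dec: "gap (Suc k) < gap k" if "k \<ge> K" for k
  proof -
    have "0 < descent_const * (d k)\<^sup>2" using descent_const_pos moves[of k] by simp
    then show ?thesis using K[OF that] by linarith
  qed
  have nonneg: "0 \<le> gap k" if "k \<ge> K" for k
  proof -
    have "decseq (\<lambda>j. gap (j + K))"
      using dec[THEN less_imp_le] by (intro decseq_SucI) simp
    then have "0 \<le> gap ((k - K) + K)"
      by (rule decseq_ge) (use LIMSEQ_ignore_initial_segment[OF gap_tendsto] in simp)
    then show ?thesis using that by simp
  qed
  have "\<forall>\<^sub>F k in sequentially. k \<ge> K" by (rule eventually_ge_at_top)
  then show ?thesis
    using eventually_gap_le
  proof eventually_elim
    case (elim k)
    \<comment> \<open>Strictness comes from one further step: a later gap is nonnegative and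
      strictly smaller.\<close>
    have pos: "0 < gap (Suc k)" using dec[of "Suc k"] nonneg[of "Suc (Suc k)"] elim(1) by simp
    \<comment> \<open>Discarding the positive gap leaves the squared step alone on the left of the
      gap estimate.\<close>
    then have "descent_const * (d k)\<^sup>2 \<le> subgrad_const * (norm (x k - xs))\<^sup>2" using elim(2) by simp
    then have "(d k)\<^sup>2 \<le> subgrad_const / descent_const * (norm (x k - xs))\<^sup>2"
      using descent_const_pos by (simp add: field_simps)
    from real_le_rsqrt[OF this]
    have "d k \<le> sqrt (subgrad_const / descent_const) * norm (x k - xs)"
      by (simp only: real_sqrt_mult real_sqrt_abs abs_norm_cancel)
    then show ?case using pos dec[OF elim(1)] K[OF elim(1)] by simp
  qed
qed

text \<open>The distance from 0 to the subdifferential at \<open>x (Suc k)\<close> is at most the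
  norm of the subgradient left by the step, so KL becomes an inequality between the gap and
  \<open>d k\<close>.\<close>

lemma KL_step:
  assumes "KL_with F xs \<phi>"
  obtains \<omega> \<rho> where "\<omega> > 0" "\<rho> > 0" "desingularizing \<omega> \<phi>"
    "\<And>k. x (Suc k) \<in> ball xs \<rho> \<Longrightarrow> 0 < gap (Suc k) \<Longrightarrow> gap (Suc k) < \<omega> \<Longrightarrow>
       1 \<le> deriv \<phi> (gap (Suc k)) * (subgrad_const * d k)"
proof -
  obtain \<omega> U where *: "\<omega> > 0" "open U" "xs \<in> U" "desingularizing \<omega> \<phi>"
    and KL: "\<And>z. z \<in> U \<Longrightarrow> F xs < F z \<Longrightarrow> F z < F xs + ereal \<omega> \<Longrightarrow>
        ereal (deriv \<phi> (real_of_ereal (F z - F xs))) * dist0 (limiting_subdiff F z) \<ge> 1"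
    using assms unfolding KL_with_def by blast
  obtain \<rho> where \<rho>: "\<rho> > 0" "ball xs \<rho> \<subseteq> U"
    using *(2,3) open_contains_ball by blast
  have "1 \<le> deriv \<phi> (gap (Suc k)) * (subgrad_const * d k)"
    if "x (Suc k) \<in> ball xs \<rho>" "0 < gap (Suc k)" "gap (Suc k) < \<omega>" for k
  proof -
    let ?D = "deriv \<phi> (gap (Suc k))"
    have D: "?D \<ge> 0" using *(4) that by (simp add: desingularizing_def less_imp_le)
    obtain \<xi> where \<xi>: "\<xi> \<in> frechet_subdiff F (x (Suc k))" "norm \<xi> \<le> subgrad_const * d k"
      using subgradient by blast
    have "dist0 (limiting_subdiff F (x (Suc k))) \<le> ereal (norm \<xi>)"
      unfolding dist0_def using \<xi>(1) frechet_subset_limiting_subdiff by (intro INF_lower) blast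
    also have "\<dots> \<le> ereal (subgrad_const * d k)" using \<xi>(2) by simp
    finally have dist: "dist0 (limiting_subdiff F (x (Suc k))) \<le> ereal (subgrad_const * d k)" .
    have "1 \<le> ereal (deriv \<phi> (real_of_ereal (F (x (Suc k)) - F xs))) * dist0 (limiting_subdiff F (x (Suc k)))"
    proof (rule KL)
      show "x (Suc k) \<in> U" using that(1) \<rho>(2) by blast
      show "F xs < F (x (Suc k))" "F (x (Suc k)) < F xs + ereal \<omega>"
        unfolding F_edom[OF x_edom] F_edom[OF cluster_edom] using that(2,3) by simp_all
    qed
    also have "\<dots> = ereal ?D * dist0 (limiting_subdiff F (x (Suc k)))" by (simp add: F_gap)
    also have "\<dots> \<le> ereal ?D * ereal (subgrad_const * d k)"
      by (rule ereal_mult_left_mono[OF dist]) (use D in simp)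
    finally show ?thesis by simp
  qed
  then show ?thesis using that *(1,4) \<rho>(1) by blast
qed

lemma KL_convergence:
  assumes "KL_with F xs \<phi>"
  shows "summable d" "x \<longlonglongrightarrow> xs"
    and "\<forall>\<^sub>F k in sequentially. 1 \<le> deriv \<phi> (gap (Suc k)) * (subgrad_const * d k) \<and>
           norm (x k - xs) \<le> 2 * d k + subgrad_const / descent_const * \<phi> (gap (Suc k))"
proof -
  obtain \<omega> \<rho> where \<omega>: "\<omega> > 0" "\<rho> > 0" "desingularizing \<omega> \<phi>"
    and KL: "\<And>k. x (Suc k) \<in> ball xs \<rho> \<Longrightarrow> 0 < gap (Suc k) \<Longrightarrow> gap (Suc k) < \<omega> \<Longrightarrow>
       1 \<le> deriv \<phi> (gap (Suc k)) * (subgrad_const * d k)"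
    using KL_step[OF assms] by metis
  obtain K where K: "\<And>k. k \<ge> K \<Longrightarrow> 0 < gap (Suc k) \<and> gap (Suc k) < gap k \<and>
     descent_const * (d k)\<^sup>2 \<le> gap k - gap (Suc k)"
    using eventually_gap unfolding eventually_sequentially by blast
  have pos: "0 < gap (k + K)" for k using K[of "k + K"] by linarith
  \<comment> \<open>The first \<open>K\<close> iterates are discarded, so the subsequence is
    reindexed. Starting it at \<open>j + K\<close> gives \<open>s (j + K) \<ge> K\<close>, so the
    natural subtraction does not truncate.\<close>
  let ?s = "\<lambda>j. s (j + K) - K"
  have sK: "K \<le> s (j + K)" for j using seq_suble[OF sub(1), of "j + K"] by linarith
  have s: "strict_mono ?s"
    unfolding strict_mono_def
    by (intro allI impI diff_less_mono strict_monoD[OF sub(1)] sK) simp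
  have "((\<lambda>k. x (k + K)) \<circ> ?s) = (\<lambda>j. (x \<circ> s) (j + K))" using sK by (auto simp: fun_eq_iff)
  then have xs: "((\<lambda>k. x (k + K)) \<circ> ?s) \<longlonglongrightarrow> xs"
    using LIMSEQ_ignore_initial_segment[OF sub(2), of K] by simp
  note conv = KL_finite_length[where x = "\<lambda>k. x (k + K)" and r = "\<lambda>k. gap (k + K)",
      OF descent_const_pos subgrad_const_pos \<omega>(1,2) _ pos LIMSEQ_ignore_initial_segment[OF gap_tendsto] s xs \<omega>(3)]
  have desc: "descent_const * (norm (x (Suc k + K) - x (k + K)))\<^sup>2 \<le> gap (k + K) - gap (Suc k + K)" for k
    using K[of "k + K"] by simp
  have KL': "1 \<le> deriv \<phi> (gap (Suc k + K)) * (subgrad_const * norm (x (Suc k + K) - x (k + K)))"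
    if "x (Suc k + K) \<in> ball xs \<rho>" "gap (Suc k + K) < \<omega>" for k
    using KL[of "k + K"] that pos[of "Suc k"] by simp
  have "summable (\<lambda>k. d (k + K))" using conv(1)[OF desc KL'] by simp
  then show "summable d" by (rule summable_iff_shift[THEN iffD1])
  show "x \<longlonglongrightarrow> xs" by (rule LIMSEQ_offset[OF conv(2)[OF desc KL']])
  show "\<forall>\<^sub>F k in sequentially. 1 \<le> deriv \<phi> (gap (Suc k)) * (subgrad_const * d k) \<and>
           norm (x k - xs) \<le> 2 * d k + subgrad_const / descent_const * \<phi> (gap (Suc k))"
    by (rule eventually_sequentially_seg[THEN iffD1]) (rule conv(3)[OF desc KL', unfolded add_Suc])
qed

lemma KL_exponent_rates:
  assumes "KL_exponent F \<theta> xs" "0 < \<theta>"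
  shows "\<theta> < 1/2 \<Longrightarrow> Q_superlinear (1 / (2 * \<theta>)) gap 0"
    and "\<theta> < 1/2 \<Longrightarrow> Q_superlinear (1 / (2 * \<theta>)) x xs"
    and "\<theta> = 1/2 \<Longrightarrow> Q_linear gap 0"
    and "\<theta> = 1/2 \<Longrightarrow> R_linear x xs"
    and "1/2 < \<theta> \<Longrightarrow> \<exists>c>0. \<forall>k\<ge>1. gap k \<le> c * real k powr (- (1 / (2 * \<theta> - 1)))"
    and "1/2 < \<theta> \<Longrightarrow> \<exists>c>0. \<forall>k\<ge>1. norm (x k - xs) \<le> c * real k powr (- ((1 - \<theta>) / (2 * \<theta> - 1)))"
proof -
  obtain c where c: "c > 0" and KL: "KL_with F xs (\<lambda>t. c * t powr (1 - \<theta>))" and "\<theta> < 1"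
    using assms(1) by (auto simp: KL_exponent_def)
  \<comment> \<open>\<open>C\<close> collects the factor \<open>c * (1 - \<theta>)\<close> of the
    derivative and the subgradient constant: multiplying KL by
    \<open>gap (Suc k) powr \<theta>\<close> gives \<open>KLd\<close>. \<open>B\<close> is the
    coefficient in the tail bound.\<close>
  define C where "C = c * (1 - \<theta>) * subgrad_const"
  define B where "B = subgrad_const / descent_const * c"
  have C: "C > 0" and B: "B \<ge> 0"
    using c \<open>\<theta> < 1\<close> subgrad_const_pos descent_const_pos by (auto simp: C_def B_def)
  have deriv: "deriv (\<lambda>t. c * t powr (1 - \<theta>)) t = c * (1 - \<theta>) * t powr (- \<theta>)" if "t > 0" for t
    using that by (intro DERIV_imp_deriv) (auto intro!: derivative_eq_intros)
  have KLd: "\<forall>\<^sub>F k in sequentially. gap (Suc k) powr \<theta> \<le> C * d k"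
    using KL_convergence(3)[OF KL] eventually_gap
  proof eventually_elim
    case (elim k)
    then have "1 \<le> C * d k * gap (Suc k) powr (- \<theta>)" by (simp add: deriv C_def mult_ac)
    then show ?case using elim by (simp add: powr_minus field_simps)
  qed
  have tail: "\<forall>\<^sub>F k in sequentially. norm (x k - xs) \<le> 2 * d k + B * gap (Suc k) powr (1 - \<theta>)"
    using KL_convergence(3)[OF KL] by eventually_elim (simp add: B_def)
  have A: "sqrt (subgrad_const / descent_const) > 0"
    using subgrad_const_pos descent_const_pos by simp
  note rates = KL_rates[where r = gap and x = x, OF descent_const_pos A C B assms(2) \<open>\<theta> < 1\<close> gap_tendsto
      KL_convergence(2)[OF KL] eventually_gap KLd tail]
  show "\<theta> < 1/2 \<Longrightarrow> Q_superlinear (1 / (2 * \<theta>)) gap 0"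
    and "\<theta> < 1/2 \<Longrightarrow> Q_superlinear (1 / (2 * \<theta>)) x xs"
    and "\<theta> = 1/2 \<Longrightarrow> Q_linear gap 0"
    and "\<theta> = 1/2 \<Longrightarrow> R_linear x xs"
    and "1/2 < \<theta> \<Longrightarrow> \<exists>c>0. \<forall>k\<ge>1. gap k \<le> c * real k powr (- (1 / (2 * \<theta> - 1)))"
    and "1/2 < \<theta> \<Longrightarrow> \<exists>c>0. \<forall>k\<ge>1. norm (x k - xs) \<le> c * real k powr (- ((1 - \<theta>) / (2 * \<theta> - 1)))"
    by (fact rates)+
qed

end

end

section \<open>Assembly in terms of the extended-valued objective\<close>

theorem theorem2p2:
  fixes f g F :: "'a::euclidean_space \<Rightarrow> ereal"
    and Lf \<alpha> :: real
    and L \<gamma> :: "nat \<Rightarrow> real"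
    and x :: "nat \<Rightarrow> 'a"
    and xs :: 'a
  assumes "\<And>z. f z \<noteq> -\<infinity>"
    and "lsc f"
    and "\<exists>U. open U \<and> edom g \<subseteq> U \<and> C1_on U f"
    and "proper g"
    and "lsc g"
    and "\<And>z. F z = f z + g z"
    and "(INF z. F z) > -\<infinity>"
    and "\<And>\<delta> z. \<delta> > 0 \<Longrightarrow> prox g \<delta> z \<noteq> {}"
    and "\<And>z. z \<in> dom_subdiff F \<Longrightarrow> KL_property F z"
    and "Lf > 0"
    and "L_smooth_on Lf (convex hull (edom g)) f"
    and "ac_pgm f g \<alpha> L \<gamma> x"
    and "\<And>k. k \<ge> 1 \<Longrightarrow> x k \<noteq> x (k - 1)"
    and "\<exists>r. strict_mono r \<and> (x \<circ> r) \<longlonglongrightarrow> xs"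
  shows "summable (\<lambda>k. norm (x (Suc k) - x k)) \<and>
    F xs < \<infinity> \<and> (\<lambda>k. F (x k)) \<longlonglongrightarrow> F xs \<and>
    x \<longlonglongrightarrow> xs \<and>
    (\<forall>\<theta>. 0 < \<theta> \<and> \<theta> < 1 \<and> KL_exponent F \<theta> xs \<longrightarrow>
      (\<theta> < 1/2 \<longrightarrow>
        Q_superlinear (1 / (2 * \<theta>)) (\<lambda>k. real_of_ereal (F (x k))) (real_of_ereal (F xs)) \<and>
        Q_superlinear (1 / (2 * \<theta>)) x xs) \<and>
      (\<theta> = 1/2 \<longrightarrow>
        Q_linear (\<lambda>k. real_of_ereal (F (x k))) (real_of_ereal (F xs)) \<and>
        R_linear x xs) \<and>
      (1/2 < \<theta> \<longrightarrow>
        (\<exists>c1>0. \<exists>c2>0. \<forall>k\<ge>1.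
          F (x k) - F xs \<le> ereal (c1 * real k powr (- (1 / (2 * \<theta> - 1)))) \<and>
          norm (x k - xs) \<le> c2 * real k powr (- ((1 - \<theta>) / (2 * \<theta> - 1))))))"
proof -
  interpret ac_pgm_run f g F Lf \<alpha> L \<gamma> x
    using assms(4-7,10-12) assms(13)[of "Suc _"] by unfold_locales auto
  obtain s where s: "strict_mono s" "(x \<circ> s) \<longlonglongrightarrow> xs" using assms(14) by blast
  let ?F = "\<lambda>z. real_of_ereal (F z)"
  note xs_edom = cluster_edom[OF s]
  have Fx: "F (x k) = ereal (?F (x k))" for k by (simp add: F_edom[OF x_edom])
  have Fxs: "F xs = ereal (?F xs)" by (simp add: F_edom[OF xs_edom])
  have gap: "fr (x k) + gr (x k) - (fr xs + gr xs) = ?F (x k) - ?F xs" for k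
    by (simp add: F_edom[OF x_edom] F_edom[OF xs_edom])
  \<comment> \<open>Any desingularizing function suffices for finite length and convergence; the
    rates use the power function of the exponent hypothesis.\<close>
  obtain \<phi> where \<phi>: "KL_with F xs \<phi>"
    using assms(9)[OF cluster_dom_subdiff[OF s]] by (auto simp: KL_property_def)
  have F_lim: "(\<lambda>k. ?F (x k)) \<longlonglongrightarrow> ?F xs"
    using R_tendsto[OF s] by (simp add: F_edom[OF x_edom] F_edom[OF xs_edom])
  note rates = KL_exponent_rates[OF s, unfolded gap]
  show ?thesis
  proof (intro conjI allI impI)
    show "summable (\<lambda>k. norm (x (Suc k) - x k))" "x \<longlonglongrightarrow> xs" by (fact KL_convergence[OF s \<phi>])+
    show "F xs < \<infinity>" by (subst Fxs) simp
    show "(\<lambda>k. F (x k)) \<longlonglongrightarrow> F xs" using tendsto_ereal[OF F_lim] by (simp flip: Fx Fxs)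
  next
    fix \<theta> assume a: "0 < \<theta> \<and> \<theta> < 1 \<and> KL_exponent F \<theta> xs" "\<theta> < 1/2"
    show "Q_superlinear (1 / (2 * \<theta>)) (\<lambda>k. ?F (x k)) (?F xs)"
      \<comment> \<open>The rate of the gap towards 0 is the rate of \<open>F (x k)\<close> towards
        \<open>F xs\<close>, as both have the same differences.\<close>
      using rates(1)[of \<theta>] a F_lim by (simp add: Q_superlinear_def)
    show "Q_superlinear (1 / (2 * \<theta>)) x xs" using rates(2) a by blast
  next
    fix \<theta> assume a: "0 < \<theta> \<and> \<theta> < 1 \<and> KL_exponent F \<theta> xs" "\<theta> = 1/2"
    show "Q_linear (\<lambda>k. ?F (x k)) (?F xs)"
      using rates(3)[of \<theta>] a F_lim by (simp add: Q_linear_def)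
    show "R_linear x xs" using rates(4) a by blast
  next
    fix \<theta> assume a: "0 < \<theta> \<and> \<theta> < 1 \<and> KL_exponent F \<theta> xs" "1/2 < \<theta>"
    obtain c1 where c1: "c1 > 0" "\<And>k. k \<ge> 1 \<Longrightarrow> ?F (x k) - ?F xs \<le> c1 * real k powr (- (1 / (2 * \<theta> - 1)))"
      using rates(5) a by blast
    obtain c2 where c2: "c2 > 0" "\<And>k. k \<ge> 1 \<Longrightarrow> norm (x k - xs) \<le> c2 * real k powr (- ((1 - \<theta>) / (2 * \<theta> - 1)))"
      using rates(6) a by blast
    have "F (x k) - F xs \<le> ereal (c1 * real k powr (- (1 / (2 * \<theta> - 1))))" if "k \<ge> 1" for k
      using c1(2)[OF that] by (subst Fx, subst Fxs) simp
    then show "\<exists>c1>0. \<exists>c2>0. \<forall>k\<ge>1.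
          F (x k) - F xs \<le> ereal (c1 * real k powr (- (1 / (2 * \<theta> - 1)))) \<and>
          norm (x k - xs) \<le> c2 * real k powr (- ((1 - \<theta>) / (2 * \<theta> - 1)))"
      using c1(1) c2 by (intro exI[of _ c1] exI[of _ c2] conjI allI impI) auto
  qed
qed

end
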